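(* Let $r\in\mathbb N$, $k_1,\dots,k_r\in\mathbb N$, and $\sigma_i\in P(k_i)$ for $i=1,\dots,r$. Let $k=\sum_{i=1}^r k_i$ and let $\gamma\in S_k$ be the trace permutation associated to $k_1,\dots,k_r$. Then for every $n$ such that the matrix $(n^{|p\vee q|})_{p,q\in D_k}$ is invertible, the classical cumulants with respect to the Haar measure on $H_n$ satisfy $$c_r[Z(\sigma_1),\dots,Z(\sigma_r)]=\#\{q\in D_k : q=\gamma(q),\ q\vee\gamma=1_k,\ q \text{ restricted to the } i\text{-th cycle of }\gamma \text{ is } \sigma_i\ (i=1,\dots,r)\}.$$
   Context: $H_n=\mathbb Z_2\wr S_n\subseteq O_n$ is the group of signed permutation matrices, with coordinate functions $u_{ij}$. $P(l)$ is the set of partitions of $\{1,\dots,l\}$. For a multi-index $\mathbf i=(i_1,\dots,i_l)$, $\ker\mathbf i\in P(l)$ is the partition in which $s,t$ are in the same block iff $i_s=i_t$. For $\sigma\in P(l)$, $Z(\sigma):=\sum_{\mathbf i\in\{1,\dots,n\}^l:\ \ker\mathbf i=\sigma}u_{i_1i_2}u_{i_2i_3}\cdots u_{i_li_1}$. $D_k$ is the set of partitions of $\{1,\dots,k\}$ all of whose blocks have even size. The trace permutation $\gamma\in S_k$ has cycles $(1,\dots,k_1)$, $(k_1+1,\dots,k_1+k_2)$, $\dots$, $(k-k_r+1,\dots,k)$; $\gamma$ is also viewed as the partition into these cycles; $\gamma(q)$ is the partition with blocks $\gamma(B)$, $B\in q$; $1_k$ is the one-block partition; $|p|$ the number of blocks,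 $\vee$ the join. "$q$ restricted to the $i$-th cycle is $\sigma_i$" means that the restriction of $q$ to $\{k_1+\dots+k_{i-1}+1,\dots,k_1+\dots+k_i\}$, relabeled by subtracting $k_1+\dots+k_{i-1}$, equals $\sigma_i$. Classical cumulants $c_r$ are defined by the moment-cumulant formula over all partitions. *)

theory Defs
  imports Complex_Main "HOL-Library.Disjoint_Sets"
begin

definition Part :: "nat \<Rightarrow> nat set set set" where
  "Part l = {p. partition_on {1..l} p}"

definition Dpart :: "nat \<Rightarrow> nat set set set" where
  "Dpart k = {p \<in> Part k. \<forall>B\<in>p. even (card B)}"

definition pjoin :: "'a set set \<Rightarrow> 'a set set \<Rightarrow> 'a set set" where
  "pjoin p q = (let R = {(x, y). \<exists>B\<in>p \<union> q. x \<in> B \<and> y \<in> B}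
                in {R\<^sup>* `` {x} | x. x \<in> \<Union>p})"

definition pimage :: "('a \<Rightarrow> 'a) \<Rightarrow> 'a set set \<Rightarrow> 'a set set" where
  "pimage f q = {f ` B | B. B \<in> q}"

definition ker :: "nat \<Rightarrow> (nat \<Rightarrow> nat) \<Rightarrow> nat set set" where
  "ker l i = {{t \<in> {1..l}. i t = i s} | s. s \<in> {1..l}}"

text \<open>Matrices are functions nat => nat => real; H_n is the set of signed permutation
  matrices with rows/columns indexed by {1..n} (entries outside vanish).
  The coordinate function u_ij is evaluation g i j.\<close>
definition Hyp :: "nat \<Rightarrow> (nat \<Rightarrow> nat \<Rightarrow> real) set" where
  "Hyp n = {g. (\<forall>i j. g i j \<in> {-1, 0, 1})
             \<and> (\<forall>i j. g i j \<noteq> 0 \<longrightarrow> i \<in> {1..n} \<and> j \<in> {1..n})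
             \<and> (\<forall>i\<in>{1..n}. \<exists>!j. g i j \<noteq> 0)
             \<and> (\<forall>j\<in>{1..n}. \<exists>!i. g i j \<noteq> 0)}"

text \<open>Integration against the Haar (= uniform) probability measure of the finite group H_n.\<close>
definition haarE :: "nat \<Rightarrow> ((nat \<Rightarrow> nat \<Rightarrow> real) \<Rightarrow> real) \<Rightarrow> real" where
  "haarE n f = (\<Sum>g\<in>Hyp n. f g) / real (card (Hyp n))"

definition Zfun :: "nat \<Rightarrow> nat \<Rightarrow> nat set set \<Rightarrow> (nat \<Rightarrow> nat \<Rightarrow> real) \<Rightarrow> real" where
  "Zfun n l \<sigma> g =
     (\<Sum>i\<in>{i \<in> PiE {1..l} (\<lambda>_. {1..n}). ker l i = \<sigma>}.
        \<Prod>s\<in>{1..l}. g (i s) (i (if s = l then 1 else s + 1)))"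

text \<open>Classical cumulants of a family X_i (i in a finite index set I) with respect to an
  expectation functional E, defined recursively by the moment-cumulant formula
  E[prod_{i in I} X_i] = sum over partitions pi of I of prod_{B in pi} c[X_i : i in B].\<close>

lemma partition_block_psubset:
  assumes "partition_on I p" "p \<noteq> {I}" "B \<in> p"
  shows "B \<subset> I"
proof -
  have sub: "B \<subseteq> I" using assms partition_onD1 by blast
  have "B \<noteq> I"
  proof
    assume BI: "B = I"
    have "p \<subseteq> {I}"
    proof
      fix C assume C: "C \<in> p"
      show "C \<in> {I}"
      proof (rule ccontr)
        assume "C \<notin> {I}"
        hence "C \<noteq> B" using BI by simp
        hence "C \<inter> B = {}" using assms(1,3) C partition_onD2 disjointD by metis
        moreover have "C \<noteq> {}" using assms(1) C partition_onD3 by blast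
        moreover have "C \<subseteq> I" using assms(1) C partition_onD1 by blast
        ultimately show False using BI by blast
      qed
    qed
    thus False using assms(2,3) BI by blast
  qed
  thus ?thesis using sub by blast
qed

function cumulant :: "(('a \<Rightarrow> real) \<Rightarrow> real) \<Rightarrow> (nat \<Rightarrow> 'a \<Rightarrow> real) \<Rightarrow> nat set \<Rightarrow> real" where
  "cumulant E X I =
     (if finite I \<and> I \<noteq> {} then
        E (\<lambda>\<omega>. \<Prod>i\<in>I. X i \<omega>)
        - (\<Sum>\<pi>\<in>{\<pi>. partition_on I \<pi> \<and> \<pi> \<noteq> {I}}. \<Prod>B\<in>\<pi>. cumulant E X B)
      else 0)"
  by pat_completeness auto
termination
proof (relation "measure (\<lambda>(E, X, I). card I)")
  show "wf (measure (\<lambda>(E, X, I). card I))" by simp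
next
  fix E :: "('a \<Rightarrow> real) \<Rightarrow> real" and X :: "nat \<Rightarrow> 'a \<Rightarrow> real" and I \<pi> B
  assume "finite I \<and> I \<noteq> {}" "\<pi> \<in> {\<pi>. partition_on I \<pi> \<and> \<pi> \<noteq> {I}}" "B \<in> \<pi>"
  thus "((E, X, B), E, X, I) \<in> measure (\<lambda>(E, X, I). card I)"
    using partition_block_psubset psubset_card_mono by fastforce
qed

declare cumulant.simps [simp del]

definition off :: "(nat \<Rightarrow> nat) \<Rightarrow> nat \<Rightarrow> nat" where
  "off k i = (\<Sum>j\<in>{1..<i}. k j)"

definition ktot :: "(nat \<Rightarrow> nat) \<Rightarrow> nat \<Rightarrow> nat" where
  "ktot k r = (\<Sum>i\<in>{1..r}. k i)"

text \<open>The trace permutation gamma with cycles (off i + 1, ..., off i + k_i):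
  m goes to m+1, except the last element off i + k_i of the i-th cycle which goes to off i + 1.
  (For k_i >= 1 at most one index i has m = off i + k_i.)\<close>
definition gam :: "(nat \<Rightarrow> nat) \<Rightarrow> nat \<Rightarrow> nat \<Rightarrow> nat" where
  "gam k r m = m + 1 - (\<Sum>i\<in>{1..r}. if m = off k i + k i then k i else 0)"

definition gpart :: "(nat \<Rightarrow> nat) \<Rightarrow> nat \<Rightarrow> nat set set" where
  "gpart k r = {{off k i + 1 .. off k i + k i} | i. i \<in> {1..r}}"

definition restr :: "(nat \<Rightarrow> nat) \<Rightarrow> nat set set \<Rightarrow> nat \<Rightarrow> nat set set" where
  "restr k q i = {(\<lambda>m. m - off k i) ` (B \<inter> {off k i + 1 .. off k i + k i}) | B.
                    B \<in> q \<and> B \<inter> {off k i + 1 .. off k i + k i} \<noteq> {}}"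

definition invertible_on :: "'i set \<Rightarrow> ('i \<Rightarrow> 'i \<Rightarrow> real) \<Rightarrow> bool" where
  "invertible_on D M \<longleftrightarrow> (\<exists>N. \<forall>p\<in>D. \<forall>q\<in>D.
      (\<Sum>t\<in>D. M p t * N t q) = (if p = q then 1 else 0)
    \<and> (\<Sum>t\<in>D. N p t * M t q) = (if p = q then 1 else 0))"

end

theory Submission
  imports Defs "HOL-Combinatorics.Permutations"
begin

text \<open>Over \<open>H\<^sub>n\<close> the integral of \<open>\<Prod>\<^sub>m u(f m, h m)\<close> vanishes unless \<open>f\<close> and \<open>h\<close> have the same kernel
  \<open>q\<close> and all blocks of \<open>q\<close> are even; in that case it is the inverse of the number of functions
  with kernel \<open>q\<close>. Applied to \<open>h = f \<circ> \<gamma>\<close>, every \<open>\<gamma>\<close>-invariant even \<open>q\<close> with the prescribed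
  restrictions contributes exactly \<open>1\<close> to the mixed moment of the \<open>Z(\<sigma>\<^sub>i)\<close>, provided that \<open>q\<close> is
  the kernel of some function into \<open>{1..n}\<close>, which the invertibility of the Gram matrix guarantees.
  Decomposing \<open>q\<close> into its connected components with respect to the cycles of \<open>\<gamma>\<close> turns this count
  into the moment-cumulant formula, so the cumulant counts the connected \<open>q\<close>.\<close>

text \<open>The moment-cumulant formula involves the moments of every subfamily \<open>I\<close> of
  the cycles, while invertibility is given only for \<open>Dpart\<close> of the total number of
  points. Kernels, integrals and components are therefore treated over arbitrary finite sets of
  points, without relabelling, and an even partition living on the cycles of \<open>I\<close> must
  be enlarged to all points before invertibility can say anything about it. The enlargement needs an
  even number of remaining points, which forces a separate parity argument when the total is odd.
  The number \<open>n\<close> enters the moments only through the question which \<open>q\<close>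
  occur as kernels; once all even ones do, the moments no longer depend on \<open>n\<close>.
  Components are described by the sets of cycles whose boundary no block of \<open>q\<close>
  crosses. Such sets are stable under difference and under the intersections that are needed, so the
  decomposition can be carried out without following paths.\<close>

lemma partition_on_block_eq:
  assumes "partition_on A P" "B \<in> P" "C \<in> P" "x \<in> B" "x \<in> C"
  shows "B = C"
  using assms disjointD[OF partition_onD2[OF assms(1)] assms(2,3)] by blast

lemma partition_on_subset_eq:
  assumes "partition_on A P" "partition_on A Q" "P \<subseteq> Q"
  shows "P = Q"
proof (intro equalityI assms(3) subsetI)
  fix C assume C: "C \<in> Q"
  then obtain x where x: "x \<in> C" using partition_onD3[OF assms(2)] by (metis ex_in_conv)
  then have "x \<in> A" using C partition_onD1[OF assms(2)] by blast
  then obtain B where "B \<in> P" "x \<in> B" using partition_onD1[OF assms(1)] by blast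
  then show "C \<in> P" using partition_on_block_eq[OF assms(2) C] x assms(3) by blast
qed

section \<open>Kernels of functions\<close>

text \<open>Generalizes \<open>ker\<close> to any index set: the product over a subfamily of the
  cycles lives on a union of cycles, which need not be an initial interval.\<close>

definition kern :: "'a set \<Rightarrow> ('a \<Rightarrow> 'b) \<Rightarrow> 'a set set" where
  "kern S f = {{t \<in> S. f t = f s} | s. s \<in> S}"

lemma ker_eq_kern: "ker l f = kern {1..l} f"
  by (simp add: ker_def kern_def)

lemma partition_on_kern: "partition_on S (kern S f)"
  by (rule partition_onI) (auto simp: kern_def disjnt_def)

lemma kern_block_const: "\<lbrakk>B \<in> kern S f; x \<in> B; y \<in> B\<rbrakk> \<Longrightarrow> f x = f y"
  by (auto simp: kern_def)

lemma kern_eq_iff: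
  "kern S f = kern S h \<longleftrightarrow> (\<forall>x\<in>S. \<forall>y\<in>S. f x = f y \<longleftrightarrow> h x = h y)"
proof
  assume eq: "kern S f = kern S h"
  show "\<forall>x\<in>S. \<forall>y\<in>S. f x = f y \<longleftrightarrow> h x = h y"
  proof (intro ballI)
    fix x y assume xy: "x \<in> S" "y \<in> S"
    have "{t \<in> S. f t = f x} \<in> kern S h" "{t \<in> S. h t = h x} \<in> kern S f"
      using xy eq by (auto simp: kern_def)
    note b = kern_block_const[OF this(1), of y x] kern_block_const[OF this(2), of y x]
    show "f x = f y \<longleftrightarrow> h x = h y"
    proof
      assume "f x = f y"
      with xy b(1) show "h x = h y" by simp
    next
      assume "h x = h y"
      with xy b(2) show "f x = f y" by simp
    qed
  qed
next
  assume "\<forall>x\<in>S. \<forall>y\<in>S. f x = f y \<longleftrightarrow> h x = h y"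
  then have "\<And>s. s \<in> S \<Longrightarrow> {t \<in> S. f t = f s} = {t \<in> S. h t = h s}" by auto
  then show "kern S f = kern S h" unfolding kern_def by (metis (no_types, lifting))
qed

lemma kern_cong: "(\<And>x. x \<in> S \<Longrightarrow> f x = h x) \<Longrightarrow> kern S f = kern S h"
  by (simp add: kern_eq_iff)

lemma kern_eq_partition_iff:
  assumes "partition_on S q"
  shows "kern S f = q \<longleftrightarrow> (\<forall>x\<in>S. \<forall>y\<in>S. f x = f y \<longleftrightarrow> (\<exists>B\<in>q. x \<in> B \<and> y \<in> B))"
proof -
  \<comment> \<open>Sending a point to its block exhibits \<open>q\<close> itself as a kernel, so
    the claim becomes a comparison of two kernels.\<close>
  define h where "h x = (THE B. B \<in> q \<and> x \<in> B)" for x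
  have h: "h x = B" if "B \<in> q" "x \<in> B" for x B
    unfolding h_def by (rule the_equality) (use that partition_on_block_eq[OF assms] in blast)+
  have ex: "\<exists>B\<in>q. x \<in> B" if "x \<in> S" for x using that partition_onD1[OF assms] by blast
  have sub: "B \<subseteq> S" if "B \<in> q" for B using that partition_onD1[OF assms] by blast
  have bl: "{t \<in> S. h t = h s} = B" if "B \<in> q" "s \<in> B" for s B
    using that h ex sub by blast
  have "kern S h \<subseteq> q"
  proof
    fix C assume "C \<in> kern S h"
    then obtain s where s: "s \<in> S" "C = {t \<in> S. h t = h s}" by (auto simp: kern_def)
    then show "C \<in> q" using ex[of s] bl by blast
  qed
  then have "kern S h = q" by (rule partition_on_subset_eq[OF partition_on_kern assms])
  moreover have "h x = h y \<longleftrightarrow> (\<exists>B\<in>q. x \<in> B \<and> y \<in> B)" if "x \<in> S" "y \<in> S" for x y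
    using that h ex by metis
  ultimately show ?thesis using kern_eq_iff[of S f h] by simp
qed

lemma kern_inj_comp:
  assumes "inj_on \<pi> (f ` S)" "\<And>x. x \<in> S \<Longrightarrow> h x = \<pi> (f x)"
  shows "kern S h = kern S f"
  using assms by (auto simp: kern_eq_iff inj_on_def)

lemma refines_kern_iff:
  assumes "partition_on S p"
  shows "refines S p (kern S f) \<longleftrightarrow> (\<forall>B\<in>p. \<forall>x\<in>B. \<forall>y\<in>B. f x = f y)"
proof
  assume r: "refines S p (kern S f)"
  show "\<forall>B\<in>p. \<forall>x\<in>B. \<forall>y\<in>B. f x = f y"
  proof (intro ballI)
    fix B x y assume B: "B \<in> p" "x \<in> B" "y \<in> B"
    then obtain C where "C \<in> kern S f" "B \<subseteq> C" using r by (auto simp: refines_def)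
    then show "f x = f y" using B kern_block_const[of C S f x y] by blast
  qed
next
  assume c: "\<forall>B\<in>p. \<forall>x\<in>B. \<forall>y\<in>B. f x = f y"
  have "\<exists>C\<in>kern S f. B \<subseteq> C" if B: "B \<in> p" for B
  proof -
    obtain x where x: "x \<in> B" using B partition_onD3[OF assms] by (metis ex_in_conv)
    have BS: "B \<subseteq> S" using B partition_onD1[OF assms] by blast
    show ?thesis
    proof
      show "B \<subseteq> {t \<in> S. f t = f x}" using c B x BS by blast
      show "{t \<in> S. f t = f x} \<in> kern S f" unfolding kern_def using x BS by blast
    qed
  qed
  then show "refines S p (kern S f)"
    unfolding refines_def using assms partition_on_kern by blast
qed

section \<open>The Gram matrix\<close>

text \<open>A function constant on the blocks of \<open>p\<close> and of \<open>t\<close> is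
  constant along the chains that generate the join. Together with \<open>refines_kern_iff\<close>
  this trades the join in the Gram matrix for two separate refinement conditions on the
  kernel.\<close>

lemma pjoin_on:
  assumes p: "partition_on S p" and t: "partition_on S t"
  shows "partition_on S (pjoin p t)"
    and "(\<forall>B\<in>pjoin p t. \<forall>x\<in>B. \<forall>y\<in>B. f x = f y) \<longleftrightarrow>
         (\<forall>B\<in>p. \<forall>x\<in>B. \<forall>y\<in>B. f x = f y) \<and> (\<forall>B\<in>t. \<forall>x\<in>B. \<forall>y\<in>B. f x = f y)"
proof -
  define R where "R = {(x, y). \<exists>B\<in>p \<union> t. x \<in> B \<and> y \<in> B}"
  have Up: "\<Union>p = S" and Ut: "\<Union>t = S" using partition_onD1 p t by auto
  have j: "pjoin p t = {R\<^sup>* `` {x} | x. x \<in> S}"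
    by (simp add: pjoin_def R_def Up)
  have "sym R" by (auto simp: R_def sym_def)
  then have sy: "sym (R\<^sup>*)" by (rule sym_rtrancl)
  have RS: "y \<in> S" if "(x, y) \<in> R" for x y using that Up Ut by (auto simp: R_def)
  have RsS: "y \<in> S" if "(x, y) \<in> R\<^sup>*" "x \<in> S" for x y
    using that by (induction) (auto intro: RS)
  show "partition_on S (pjoin p t)"
  proof (rule partition_onI)
    show "\<Union>(pjoin p t) = S" using RsS by (auto simp: j)
    show "{} \<notin> pjoin p t" by (auto simp: j)
    show "disjnt B C" if BC: "B \<in> pjoin p t" "C \<in> pjoin p t" "B \<noteq> C" for B C
    proof (rule ccontr)
      assume "\<not> disjnt B C"
      then obtain z where z: "z \<in> B" "z \<in> C" by (auto simp: disjnt_def)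
      obtain x y where xy: "B = R\<^sup>* `` {x}" "C = R\<^sup>* `` {y}" using BC by (auto simp: j)
      have eq: "R\<^sup>* `` {w} = R\<^sup>* `` {z}" if "(w, z) \<in> R\<^sup>*" for w
        using that symD[OF sy that] by (auto intro: rtrancl_trans)
      have "B = R\<^sup>* `` {z}" "C = R\<^sup>* `` {z}"
        using z eq[of x] eq[of y] unfolding xy by simp_all
      then show False using BC(3) by simp
    qed
  qed
  show "(\<forall>B\<in>pjoin p t. \<forall>x\<in>B. \<forall>y\<in>B. f x = f y) \<longleftrightarrow>
         (\<forall>B\<in>p. \<forall>x\<in>B. \<forall>y\<in>B. f x = f y) \<and> (\<forall>B\<in>t. \<forall>x\<in>B. \<forall>y\<in>B. f x = f y)" (is "?l \<longleftrightarrow> ?r")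
  proof
    assume l: ?l
    have "f x = f y" if "B \<in> p \<union> t" "x \<in> B" "y \<in> B" for B x y
    proof -
      have "x \<in> S" using that Up Ut by blast
      moreover have "(x, y) \<in> R" using that by (auto simp: R_def)
      ultimately show ?thesis using l by (auto simp: j)
    qed
    then show ?r by blast
  next
    assume r: ?r
    have R1: "f x = f y" if "(x, y) \<in> R" for x y
      using that r unfolding R_def by blast
    have eq: "f x = f y" if "(x, y) \<in> R\<^sup>*" for x y
      using that by induction (simp_all add: R1)
    show ?l
    proof (intro ballI)
      fix B x y assume B: "B \<in> pjoin p t" "x \<in> B" "y \<in> B"
      then obtain z where "(z, x) \<in> R\<^sup>*" "(z, y) \<in> R\<^sup>*" by (auto simp: j)
      then show "f x = f y" using eq[of z x] eq[of z y] by simp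
    qed
  qed
qed

text \<open>Such functions are the functions on the set of blocks: \<open>b\<close> sends a point to
  its block, and a chosen representative \<open>c B\<close> of each block gives the inverse
  map.\<close>

lemma card_block_constant:
  assumes P: "partition_on S P" and fin: "finite S"
  shows "card {f \<in> PiE S (\<lambda>_. A). \<forall>B\<in>P. \<forall>x\<in>B. \<forall>y\<in>B. f x = f y} = card A ^ card P"
    (is "card ?F = _")
proof -
  define b where "b x = (THE B. B \<in> P \<and> x \<in> B)" for x
  have b: "b x = B" if "B \<in> P" "x \<in> B" for x B
    unfolding b_def by (rule the_equality) (use that partition_on_block_eq[OF P] in blast)+
  have ex: "b x \<in> P \<and> x \<in> b x" if "x \<in> S" for x using that partition_onD1[OF P] b by fastforce
  have sub: "B \<subseteq> S" if "B \<in> P" for B using that partition_onD1[OF P] by blast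
  define c where "c B = (SOME x. x \<in> B)" for B :: "'a set"
  have c: "c B \<in> B" if "B \<in> P" for B
    unfolding c_def using that partition_onD3[OF P] by (metis someI_ex ex_in_conv)
  have "bij_betw (\<lambda>h. restrict (\<lambda>x. h (b x)) S) (PiE P (\<lambda>_. A)) ?F"
  proof (rule bij_betw_byWitness[where f' = "\<lambda>f. restrict (\<lambda>B. f (c B)) P"])
    show "\<forall>h\<in>PiE P (\<lambda>_. A). restrict (\<lambda>B. restrict (\<lambda>x. h (b x)) S (c B)) P = h"
      using c b sub by (auto intro!: PiE_ext simp: subset_iff)
    show "\<forall>f\<in>?F. restrict (\<lambda>x. restrict (\<lambda>B. f (c B)) P (b x)) S = f"
    proof
      fix f assume f: "f \<in> ?F"
      show "restrict (\<lambda>x. restrict (\<lambda>B. f (c B)) P (b x)) S = f"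
      proof (rule extensionalityI[of _ S])
        show "f \<in> extensional S" using f by (auto simp: PiE_def)
        fix x assume x: "x \<in> S"
        then show "restrict (\<lambda>x. restrict (\<lambda>B. f (c B)) P (b x)) S x = f x"
          using ex[OF x] c[of "b x"] f by auto
      qed auto
    qed
    show "(\<lambda>h. restrict (\<lambda>x. h (b x)) S) ` PiE P (\<lambda>_. A) \<subseteq> ?F"
      using ex sub b by (auto simp: subset_iff)
    show "(\<lambda>f. restrict (\<lambda>B. f (c B)) P) ` ?F \<subseteq> PiE P (\<lambda>_. A)"
      using c sub by (fastforce simp: PiE_iff)
  qed
  then have "card ?F = card (PiE P (\<lambda>_. A))" by (rule bij_betw_same_card[symmetric])
  also have "\<dots> = card A ^ card P" using finite_elements[OF fin P] by (simp add: card_PiE)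
  finally show ?thesis .
qed

text \<open>A coarse block is the disjoint union of the fine blocks inside it. Consequently every
  kernel above an element of \<open>Dpart\<close> lies in \<open>Dpart\<close> again, and the
  expansion of the Gram matrix stays within the index set of the matrix.\<close>

lemma even_blocks_coarsen:
  assumes fin: "finite S" and r: "refines S p q" and ev: "\<forall>B\<in>p. even (card B)"
  shows "\<forall>C\<in>q. even (card C)"
proof
  fix C assume C: "C \<in> q"
  have p: "partition_on S p" and q: "partition_on S q" using r by (auto simp: refines_def)
  obtain P where P: "partition_on C P" "P = {B \<in> p. B \<subseteq> C}"
  proof
    show "partition_on C {B \<in> p. B \<subseteq> C}"
    proof (rule partition_onI)
      show "\<Union>{B \<in> p. B \<subseteq> C} = C"
      proof
        show "C \<subseteq> \<Union>{B \<in> p. B \<subseteq> C}"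
        proof
          fix x assume x: "x \<in> C"
          then have "x \<in> S" using C partition_onD1[OF q] by blast
          then obtain B where B: "B \<in> p" "x \<in> B" using partition_onD1[OF p] by blast
          then obtain D where D: "D \<in> q" "B \<subseteq> D" using r by (auto simp: refines_def)
          then have "D = C" using partition_on_block_eq[OF q] C x B by blast
          then show "x \<in> \<Union>{B \<in> p. B \<subseteq> C}" using B D by blast
        qed
      qed auto
    qed (use p in \<open>auto simp: partition_on_def disjoint_def disjnt_def\<close>)
  qed auto
  have "finite C" using C partition_onD1[OF q] fin by (metis Union_upper finite_subset)
  then have "card C = (\<Sum>B\<in>P. card B)"
    by (intro product_partition[OF P(1)]) (use P(2) finite_subset in blast)
  then show "even (card C)" using P ev by (auto intro!: dvd_sum)
qed

lemma finite_Dpart: "finite (Dpart k)"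
  unfolding Dpart_def Part_def
  by (rule finite_subset[OF _ finitely_many_partition_on[of "{1..k}"]]) auto

text \<open>The left side counts the functions constant on the blocks of both partitions; the right
  side sorts the same functions by their kernel.\<close>

lemma gram_entry:
  assumes p: "p \<in> Dpart k" and t: "t \<in> Dpart k"
  shows "real n ^ card (pjoin p t) =
    (\<Sum>s\<in>{s\<in>Dpart k. refines {1..k} p s \<and> refines {1..k} t s}.
       real (card {f \<in> PiE {1..k} (\<lambda>_. {1..n}). kern {1..k} f = s}))"
proof -
  let ?S = "{1..k}" and ?F = "PiE {1..k} (\<lambda>_. {1..n})"
  let ?D = "{s\<in>Dpart k. refines ?S p s \<and> refines ?S t s}"
  have p': "partition_on ?S p" and t': "partition_on ?S t"
    using p t by (auto simp: Dpart_def Part_def)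
  have fF: "finite ?F" by (intro finite_PiE) auto
  have "n ^ card (pjoin p t) = card {f \<in> ?F. \<forall>B\<in>pjoin p t. \<forall>x\<in>B. \<forall>y\<in>B. f x = f y}"
    by (subst card_block_constant[OF pjoin_on(1)[OF p' t']]) simp_all
  also have "{f \<in> ?F. \<forall>B\<in>pjoin p t. \<forall>x\<in>B. \<forall>y\<in>B. f x = f y} =
      {f \<in> ?F. refines ?S p (kern ?S f) \<and> refines ?S t (kern ?S f)}"
    by (simp only: pjoin_on(2)[OF p' t'] refines_kern_iff[OF p'] refines_kern_iff[OF t'])
  also have "\<dots> = (\<Union>s\<in>?D. {f \<in> ?F. kern ?S f = s})"
    using p even_blocks_coarsen[of ?S p] partition_on_kern[of ?S]
    by (auto simp: Dpart_def Part_def)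
  also have "card \<dots> = (\<Sum>s\<in>?D. card {f \<in> ?F. kern ?S f = s})"
    using fF finite_Dpart[of k] by (intro card_UN_disjoint) auto
  finally have "real (n ^ card (pjoin p t)) = real (\<Sum>s\<in>?D. card {f \<in> ?F. kern ?S f = s})" by simp
  then show ?thesis by simp
qed

text \<open>The Gram matrix factors as \<open>A\<^sup>T F A\<close> with \<open>A\<close> the unitriangular zeta matrix of the refinement
  order and \<open>F\<close> diagonal with entries the numbers of functions with given kernel, so invertibility
  forces all these numbers to be nonzero.\<close>

lemma invertible_imp_kernel_exists:
  assumes inv: "invertible_on (Dpart k) (\<lambda>p q. real n ^ card (pjoin p q))" and q: "q \<in> Dpart k"
  shows "\<exists>f\<in>PiE {1..k} (\<lambda>_. {1..n}). kern {1..k} f = q"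
proof -
  let ?D = "Dpart k" and ?le = "refines {1..k}"
  obtain N where N: "\<And>p. p \<in> ?D \<Longrightarrow>
      (\<Sum>t\<in>?D. real n ^ card (pjoin p t) * N t q) = (if p = q then 1 else 0)"
    using inv q unfolding invertible_on_def by blast
  define F where "F s = real (card {f \<in> PiE {1..k} (\<lambda>_. {1..n}). kern {1..k} f = s})" for s
  \<comment> \<open>This is column \<open>q\<close> of the product of diagonal matrix, zeta matrix
    and inverse Gram matrix \<open>N\<close>. Applying the transposed zeta matrix to it must give
    the unit vector at \<open>q\<close>, which is \<open>ysum\<close>.\<close>
  define y where "y s = F s * (\<Sum>t\<in>{t\<in>?D. ?le t s}. N t q)" for s
  have fD: "finite ?D" by (rule finite_Dpart)
  have le_refl: "?le p p" if "p \<in> ?D" for p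
    using that by (auto simp: Dpart_def Part_def intro: refines_refl)
  have ysum: "(\<Sum>s\<in>{s\<in>?D. ?le p s}. y s) = (if p = q then 1 else 0)" if p: "p \<in> ?D" for p
  proof -
    have "(if p = q then 1 else 0) = (\<Sum>t\<in>?D. real n ^ card (pjoin p t) * N t q)"
      using N[OF p] by simp
    also have "\<dots> = (\<Sum>t\<in>?D. \<Sum>s\<in>{s\<in>?D. ?le p s \<and> ?le t s}. F s * N t q)"
      by (intro sum.cong refl) (simp add: gram_entry[OF p] F_def sum_distrib_right)
    also have "\<dots> = (\<Sum>t\<in>?D. \<Sum>s\<in>{s\<in>?D. ?le p s}. if ?le t s then F s * N t q else 0)"
      using fD by (intro sum.cong refl sum.mono_neutral_cong_left) auto
    also have "\<dots> = (\<Sum>s\<in>{s\<in>?D. ?le p s}. \<Sum>t\<in>?D. if ?le t s then F s * N t q else 0)"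
      by (rule sum.swap)
    also have "\<dots> = (\<Sum>s\<in>{s\<in>?D. ?le p s}. y s)"
      unfolding y_def sum_distrib_left using fD
      by (intro sum.cong refl sum.mono_neutral_cong_right) auto
    finally show ?thesis by simp
  qed
  \<comment> \<open>Back substitution from coarse to fine: whatever is coarser than a
    \<open>p\<close> not below \<open>q\<close> is not below \<open>q\<close> either, so in
    \<open>ysum\<close> only the term \<open>y p\<close> is left. Applied once more at
    \<open>q\<close>, this gives \<open>y q = 1\<close>, which rules out
    \<open>F q = 0\<close>.\<close>
  have y0: "y p = 0" if "p \<in> ?D" "\<not> ?le p q" for p
    using that
  proof (induction "card {s\<in>?D. ?le p s}" arbitrary: p rule: less_induct)
    case less
    have "y s = 0" if s: "s \<in> {s\<in>?D. ?le p s} - {p}" for s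
    proof -
      have "\<not> ?le s p" using s refines_asym by blast
      then have "{u\<in>?D. ?le s u} \<subset> {u\<in>?D. ?le p u}"
        using s less.prems le_refl refines_trans by blast
      then have "card {u\<in>?D. ?le s u} < card {u\<in>?D. ?le p u}"
        using fD by (intro psubset_card_mono) auto
      moreover have "\<not> ?le s q" using s less.prems refines_trans by blast
      ultimately show ?thesis using less.hyps s by blast
    qed
    then have "(\<Sum>s\<in>{s\<in>?D. ?le p s}. y s) = y p"
      using fD less.prems le_refl by (subst sum.remove[of _ p]) auto
    moreover have "p \<noteq> q" using less.prems le_refl by blast
    ultimately show ?case using ysum[OF less.prems(1)] by simp
  qed
  have "y s = 0" if "s \<in> {s\<in>?D. ?le q s} - {q}" for s
    using that y0 refines_asym by blast
  then have "(\<Sum>s\<in>{s\<in>?D. ?le q s}. y s) = y q"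
    using fD q le_refl by (subst sum.remove[of _ q]) auto
  then have "y q = 1" using ysum[OF q] by simp
  then have "F q \<noteq> 0" by (auto simp: y_def)
  then have "{f \<in> PiE {1..k} (\<lambda>_. {1..n}). kern {1..k} f = q} \<noteq> {}"
    by (auto simp: F_def simp del: Collect_empty_eq)
  then show ?thesis by blast
qed

section \<open>Haar integration on signed permutation matrices\<close>

lemma HypD:
  assumes "g \<in> Hyp n"
  shows "g i j \<in> {-1, 0, 1}" and "g i j \<noteq> 0 \<Longrightarrow> i \<in> {1..n} \<and> j \<in> {1..n}"
    and "i \<in> {1..n} \<Longrightarrow> \<exists>!j. g i j \<noteq> 0" and "j \<in> {1..n} \<Longrightarrow> \<exists>!i. g i j \<noteq> 0"
  using assms unfolding Hyp_def mem_Collect_eq by (iprover | blast)+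

lemma HypI:
  assumes "\<And>i j. g i j \<in> {-1, 0, 1}" "\<And>i j. g i j \<noteq> 0 \<Longrightarrow> i \<in> {1..n} \<and> j \<in> {1..n}"
    "\<And>i. i \<in> {1..n} \<Longrightarrow> \<exists>!j. g i j \<noteq> 0" "\<And>j. j \<in> {1..n} \<Longrightarrow> \<exists>!i. g i j \<noteq> 0"
  shows "g \<in> Hyp n"
  unfolding Hyp_def mem_Collect_eq by (intro conjI allI ballI impI assms)

lemma Hyp_nonzero_unique:
  assumes "g \<in> Hyp n"
  shows "\<lbrakk>g i j \<noteq> 0; g i j' \<noteq> 0\<rbrakk> \<Longrightarrow> j = j'" and "\<lbrakk>g i j \<noteq> 0; g i' j \<noteq> 0\<rbrakk> \<Longrightarrow> i = i'"
  using HypD(2,3,4)[OF assms] by metis+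

lemma Hyp_support_permutation:
  assumes g: "g \<in> Hyp n"
  obtains \<pi> where "inj_on \<pi> {1..n}" "\<And>i. i \<in> {1..n} \<Longrightarrow> \<pi> i \<in> {1..n}"
    "\<And>i j. i \<in> {1..n} \<Longrightarrow> g i j \<noteq> 0 \<longleftrightarrow> j = \<pi> i"
proof -
  have "\<forall>i\<in>{1..n}. \<exists>j. g i j \<noteq> 0" using HypD(3)[OF g] by blast
  then obtain \<pi> where p: "\<forall>i\<in>{1..n}. g i (\<pi> i) \<noteq> 0" by metis
  show thesis
  proof
    show "inj_on \<pi> {1..n}"
      by (rule inj_onI) (metis p Hyp_nonzero_unique(2)[OF g])
    show "\<pi> i \<in> {1..n}" if "i \<in> {1..n}" for i
      using p that HypD(2)[OF g] by blast
    show "g i j \<noteq> 0 \<longleftrightarrow> j = \<pi> i" if "i \<in> {1..n}" for i j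
      using p that Hyp_nonzero_unique(1)[OF g] by blast
  qed
qed

lemma finite_Hyp: "finite (Hyp n)"
proof -
  let ?V = "PiE ({1..n} \<times> {1..n}) (\<lambda>_. {-1, 0, 1 :: real})"
  \<comment> \<open>Elements of \<open>Hyp n\<close> are functions on all pairs of naturals, but
    they vanish off the grid and are therefore determined by their restriction to it.\<close>
  have "inj_on (\<lambda>g. restrict (case_prod g) ({1..n} \<times> {1..n})) (Hyp n)"
  proof (rule inj_onI, intro ext)
    fix g h i j assume gh: "g \<in> Hyp n" "h \<in> Hyp n"
      and eq: "restrict (case_prod g) ({1..n} \<times> {1..n}) = restrict (case_prod h) ({1..n} \<times> {1..n})"
    show "g i j = h i j"
    proof (cases "i \<in> {1..n} \<and> j \<in> {1..n}")
      case True
      then show ?thesis using fun_cong[OF eq, of "(i, j)"] by simp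
    next
      case False
      then have "g i j = 0" "h i j = 0" using HypD(2)[OF gh(1)] HypD(2)[OF gh(2)] by blast+
      then show ?thesis by simp
    qed
  qed
  moreover have "(\<lambda>g. restrict (case_prod g) ({1..n} \<times> {1..n})) ` Hyp n \<subseteq> ?V"
    by (intro image_subsetI restrict_PiE_iff[THEN iffD2] ballI)
      (unfold case_prod_beta, erule HypD(1))
  moreover have "finite ?V" by (intro finite_PiE) auto
  ultimately show ?thesis using finite_imageD finite_subset by blast
qed

lemma card_Hyp_pos: "card (Hyp n) > 0"
proof -
  have "(\<lambda>i j. if i = j \<and> i \<in> {1..n} then 1 else 0) \<in> Hyp n"
    by (auto simp: Hyp_def)
  then show ?thesis using finite_Hyp card_gt_0_iff by blast
qed

section \<open>Linearity and invariance of the integral\<close>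

lemma haarE_sum: "haarE n (\<lambda>g. \<Sum>x\<in>A. F x g) = (\<Sum>x\<in>A. haarE n (F x))"
  unfolding haarE_def by (subst sum.swap) (simp add: sum_divide_distrib)

lemma haarE_const: "(\<And>g. g \<in> Hyp n \<Longrightarrow> F g = c) \<Longrightarrow> haarE n F = c"
  using card_Hyp_pos[of n] by (simp add: haarE_def)

lemma haarE_permute_columns:
  assumes \<tau>: "\<tau> permutes {1..n}"
  shows "haarE n (\<lambda>g. F (\<lambda>i j. g i (\<tau> j))) = haarE n F"
proof -
  have closed: "(\<lambda>i j. g i (\<rho> j)) \<in> Hyp n" if g: "g \<in> Hyp n" and \<rho>: "\<rho> permutes {1..n}" for g \<rho>
  proof (rule HypI)
    show "g i (\<rho> j) \<in> {-1, 0, 1}" for i j by (rule HypD(1)[OF g])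
    show "i \<in> {1..n} \<and> j \<in> {1..n}" if "g i (\<rho> j) \<noteq> 0" for i j
      using HypD(2)[OF g that] permutes_in_image[OF \<rho>] by simp
    show "\<exists>!j. g i (\<rho> j) \<noteq> 0" if "i \<in> {1..n}" for i
      using HypD(3)[OF g that] permutes_inverses[OF \<rho>] by metis
    show "\<exists>!i. g i (\<rho> j) \<noteq> 0" if "j \<in> {1..n}" for j
      by (rule HypD(4)[OF g]) (use that permutes_in_image[OF \<rho>] in blast)
  qed
  note \<tau>' = permutes_inv[OF \<tau>] 
  have "(\<Sum>g\<in>Hyp n. F (\<lambda>i j. g i (\<tau> j))) = (\<Sum>g\<in>Hyp n. F g)"
    by (rule sum.reindex_bij_witness[where i = "\<lambda>g i j. g i (inv \<tau> j)" and j = "\<lambda>g i j. g i (\<tau> j)"])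
      (use closed \<tau> \<tau>' permutes_inverses[OF \<tau>] in auto)
  then show ?thesis by (simp add: haarE_def)
qed

lemma haarE_negate_row: "haarE n (\<lambda>g. F (\<lambda>i j. if i = a then - g i j else g i j)) = haarE n F"
proof -
  have closed: "(\<lambda>i j. if i = a then - g i j else g i j) \<in> Hyp n" if "g \<in> Hyp n" for g
  proof -
    have nz: "(if i = a then - g i j else g i j) \<noteq> 0 \<longleftrightarrow> g i j \<noteq> 0" for i j by simp
    have v: "(if i = a then - g i j else g i j) \<in> {-1, 0, 1}" for i j
      using HypD(1)[OF that, of i j] by auto
    show ?thesis by (rule HypI; (unfold nz)?; (rule v | rule HypD(2-4)[OF that])) assumption+
  qed
  have "(\<Sum>g\<in>Hyp n. F (\<lambda>i j. if i = a then - g i j else g i j)) = (\<Sum>g\<in>Hyp n. F g)"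
    by (rule sum.reindex_bij_witness[where i = "\<lambda>g i j. if i = a then - g i j else g i j"
          and j = "\<lambda>g i j. if i = a then - g i j else g i j"])
      (use closed in \<open>auto simp: fun_eq_iff cong: if_cong\<close>)
  then show ?thesis by (simp add: haarE_def)
qed

text \<open>Equality of the kernels makes \<open>f x \<mapsto> h x\<close> a well-defined bijection
  between the two ranges. Their complements in the finite set \<open>A\<close> then have the same
  size, and any bijection between them completes it to a permutation.\<close>

lemma extend_to_permutation:
  assumes fin: "finite A" and f: "f ` S \<subseteq> A" and h: "h ` S \<subseteq> A" and k: "kern S f = kern S h"
  obtains \<tau> where "\<tau> permutes A" "\<And>x. x \<in> S \<Longrightarrow> h x = \<tau> (f x)"
proof -
  have fh: "f x = f y \<longleftrightarrow> h x = h y" if "x \<in> S" "y \<in> S" for x y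
    using k that unfolding kern_eq_iff by blast
  define \<theta> where "\<theta> a = h (SOME x. x \<in> S \<and> f x = a)" for a
  have th: "\<theta> (f x) = h x" if "x \<in> S" for x
  proof -
    have "(SOME y. y \<in> S \<and> f y = f x) \<in> S \<and> f (SOME y. y \<in> S \<and> f y = f x) = f x"
      by (rule someI[of _ x]) (use that in simp)
    then show ?thesis unfolding \<theta>_def using fh that by blast
  qed
  have b1: "bij_betw \<theta> (f ` S) (h ` S)"
    unfolding bij_betw_def inj_on_def using th fh by (auto simp: image_image)
  then have "card (f ` S) = card (h ` S)" by (rule bij_betw_same_card)
  then have "card (A - f ` S) = card (A - h ` S)"
    using fin f h by (simp add: card_Diff_subset finite_subset)
  then obtain \<rho> where b2: "bij_betw \<rho> (A - f ` S) (A - h ` S)"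
    using fin by (metis finite_Diff finite_same_card_bij)
  define \<tau> where "\<tau> a = (if a \<in> f ` S then \<theta> a else if a \<in> A then \<rho> a else a)" for a
  have "bij_betw \<tau> (f ` S \<union> (A - f ` S)) (h ` S \<union> (A - h ` S))"
  proof (rule bij_betw_combine)
    show "bij_betw \<tau> (f ` S) (h ` S)" using b1 by (subst bij_betw_cong[where g = \<theta>]) (auto simp: \<tau>_def)
    show "bij_betw \<tau> (A - f ` S) (A - h ` S)"
      using b2 by (subst bij_betw_cong[where g = \<rho>]) (auto simp: \<tau>_def)
  qed auto
  then have "bij_betw \<tau> A A" using f h by (simp add: Un_absorb1)
  then have "\<tau> permutes A" by (rule bij_imp_permutes) (use f in \<open>auto simp: \<tau>_def\<close>)
  moreover have "h x = \<tau> (f x)" if "x \<in> S" for x using th that by (simp add: \<tau>_def)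
  ultimately show thesis using that by blast
qed

text \<open>Flipping the sign of the row that belongs to \<open>B\<close> multiplies the monomial by
  \<open>(-1) ^ card B = -1\<close> and preserves the integral, so the integral equals its own
  negative.\<close>

lemma haarE_monomial_odd:
  assumes fin: "finite S" and B: "B \<in> kern S f" "odd (card B)"
  shows "haarE n (\<lambda>g. \<Prod>m\<in>S. g (f m) (h m)) = 0"
proof -
  obtain s where s: "s \<in> S" "B = {t \<in> S. f t = f s}" using B(1) by (auto simp: kern_def)
  have "(\<Prod>m\<in>S. if f m = f s then - g (f m) (h m) else g (f m) (h m))
      = - (\<Prod>m\<in>S. g (f m) (h m))" for g :: "nat \<Rightarrow> nat \<Rightarrow> real"
  proof -
    have "(\<Prod>m\<in>S. if f m = f s then - g (f m) (h m) else g (f m) (h m))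
      = (\<Prod>m\<in>S. (if f m = f s then - 1 else 1) * g (f m) (h m))"
      by (intro prod.cong) auto
    also have "\<dots> = (\<Prod>m\<in>S. if f m = f s then - 1 else 1) * (\<Prod>m\<in>S. g (f m) (h m))"
      by (rule prod.distrib)
    also have "(\<Prod>m\<in>S. if f m = f s then - 1 else 1 :: real) = (- 1) ^ card B"
      using fin s by (simp add: prod.If_cases Int_def)
    finally show ?thesis using B(2) by simp
  qed
  then have "haarE n (\<lambda>g. - (\<Prod>m\<in>S. g (f m) (h m))) = haarE n (\<lambda>g. \<Prod>m\<in>S. g (f m) (h m))"
    using haarE_negate_row[of n "\<lambda>g. \<Prod>m\<in>S. g (f m) (h m)" "f s"] by simp
  then show ?thesis by (simp add: haarE_def sum_negf)
qed

text \<open>The monomial vanishes at every \<open>g\<close>: where the kernels differ it asks for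
  two nonzero entries in one row or in one column.\<close>

lemma haarE_monomial_kern_neq:
  assumes fin: "finite S" and k: "kern S f \<noteq> kern S h"
  shows "haarE n (\<lambda>g. \<Prod>m\<in>S. g (f m) (h m)) = 0"
proof (rule haarE_const)
  fix g assume g: "g \<in> Hyp n"
  obtain x y where xy: "x \<in> S" "y \<in> S" "(f x = f y) \<noteq> (h x = h y)"
    using k unfolding kern_eq_iff by blast
  have "g (f x) (h x) = 0 \<or> g (f y) (h y) = 0"
    using xy(3) Hyp_nonzero_unique[OF g] by metis
  then show "(\<Prod>m\<in>S. g (f m) (h m)) = 0" using fin xy by (auto simp: prod_zero_iff)
qed

text \<open>Here \<open>w a\<close> is the sign in row \<open>a\<close>. It occurs once for each
  point that \<open>f\<close> sends to \<open>a\<close>, hence an even number of times.\<close>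

lemma prod_even_blocks:
  assumes fin: "finite S" and ev: "\<forall>B\<in>kern S f. even (card B)"
    and w: "\<And>m. m \<in> S \<Longrightarrow> w (f m) = 1 \<or> w (f m) = (- 1 :: real)"
  shows "(\<Prod>m\<in>S. w (f m)) = 1"
proof -
  have "(\<Prod>m\<in>S. w (f m)) = (\<Prod>B\<in>kern S f. \<Prod>m\<in>B. w (f m))"
    using prod.partition[OF fin partition_on_kern] .
  also have "\<dots> = 1"
  proof (rule prod.neutral, rule ballI)
    fix B assume B: "B \<in> kern S f"
    then obtain s where s: "s \<in> S" "B = {t \<in> S. f t = f s}" by (auto simp: kern_def)
    then have "(\<Prod>m\<in>B. w (f m)) = (\<Prod>m\<in>B. w (f s))" by (intro prod.cong) auto
    also have "\<dots> = w (f s) ^ card B" by simp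
    also have "\<dots> = 1" using w[OF s(1)] ev B by auto
    finally show "(\<Prod>m\<in>B. w (f m)) = 1" .
  qed
  finally show ?thesis .
qed

text \<open>Exactly one \<open>h\<close> survives, namely \<open>\<pi> \<circ> f\<close> with \<pi>
  the permutation underlying \<open>g\<close>. It belongs to the index set of the sum because \<pi>
  is injective, and the signs in its monomial cancel by evenness.\<close>

lemma sum_monomials_kern:
  assumes fin: "finite S" and f: "f ` S \<subseteq> {1..n}" and ev: "\<forall>B\<in>kern S f. even (card B)"
    and g: "g \<in> Hyp n"
  shows "(\<Sum>h\<in>{h \<in> PiE S (\<lambda>_. {1..n}). kern S h = kern S f}. \<Prod>m\<in>S. g (f m) (h m)) = 1"
proof -
  obtain \<pi> where pi: "inj_on \<pi> {1..n}" "\<And>i. i \<in> {1..n} \<Longrightarrow> \<pi> i \<in> {1..n}"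
    "\<And>i j. i \<in> {1..n} \<Longrightarrow> g i j \<noteq> 0 \<longleftrightarrow> j = \<pi> i"
    by (rule Hyp_support_permutation[OF g]) (rule that)
  let ?A = "{h \<in> PiE S (\<lambda>_. {1..n}). kern S h = kern S f}"
  define h0 where "h0 = restrict (\<lambda>m. \<pi> (f m)) S"
  have "kern S h0 = kern S f"
    by (rule kern_inj_comp[of \<pi>]) (use pi(1) f inj_on_subset h0_def in auto)
  then have h0: "h0 \<in> ?A" using f pi(2) by (auto simp: h0_def)
  have finA: "finite ?A" using fin by (intro finite_subset[OF _ finite_PiE[of S "\<lambda>_. {1..n}"]]) auto
  have zero: "(\<Prod>m\<in>S. g (f m) (h m)) = 0" if h: "h \<in> ?A - {h0}" for h
  proof -
    obtain m where "m \<in> S" "h m \<noteq> h0 m"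
      using h h0 PiE_ext[of h S "\<lambda>_. {1..n}" h0] by blast
    then have "g (f m) (h m) = 0" using pi(3)[of "f m" "h m"] f by (auto simp: h0_def)
    then show ?thesis using fin \<open>m \<in> S\<close> by (auto simp: prod_zero_iff)
  qed
  have "(\<Sum>h\<in>?A. \<Prod>m\<in>S. g (f m) (h m)) = (\<Prod>m\<in>S. g (f m) (h0 m))"
    using zero by (subst sum.remove[OF finA h0]) simp
  also have "\<dots> = (\<Prod>m\<in>S. g (f m) (\<pi> (f m)))"
    by (intro prod.cong) (auto simp: h0_def)
  also have "\<dots> = 1"
  proof (rule prod_even_blocks[where w = "\<lambda>a. g a (\<pi> a)", OF fin ev])
    fix m assume "m \<in> S"
    then have "g (f m) (\<pi> (f m)) \<noteq> 0" using pi(3) f by blast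
    moreover have "g (f m) (\<pi> (f m)) \<in> {-1, 0, 1}" using HypD(1)[OF g] .
    ultimately show "g (f m) (\<pi> (f m)) = 1 \<or> g (f m) (\<pi> (f m)) = - 1" by auto
  qed
  finally show ?thesis .
qed

text \<open>By invariance under column permutations the integral depends only on the kernel of \<open>h\<close>, and
  the sum over all \<open>h\<close> with this kernel is pointwise \<open>1\<close>.\<close>

lemma haarE_monomial_even:
  assumes fin: "finite S" and f: "f ` S \<subseteq> {1..n}" and h: "h ` S \<subseteq> {1..n}"
    and k: "kern S f = kern S h" and ev: "\<forall>B\<in>kern S f. even (card B)"
  shows "haarE n (\<lambda>g. \<Prod>m\<in>S. g (f m) (h m)) *
    real (card {h \<in> PiE S (\<lambda>_. {1..n}). kern S h = kern S f}) = 1"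
proof -
  let ?A = "{h \<in> PiE S (\<lambda>_. {1..n}). kern S h = kern S f}"
  have "haarE n (\<lambda>g. \<Prod>m\<in>S. g (f m) (h' m)) = haarE n (\<lambda>g. \<Prod>m\<in>S. g (f m) (h m))"
    if h': "h' \<in> ?A" for h'
  proof -
    have "h' ` S \<subseteq> {1..n}" "kern S h = kern S h'" using h' k by auto
    then obtain \<tau> where t: "\<tau> permutes {1..n}" "\<And>x. x \<in> S \<Longrightarrow> h' x = \<tau> (h x)"
      using extend_to_permutation[of "{1..n}" h S h'] h by blast
    have "haarE n (\<lambda>g. \<Prod>m\<in>S. g (f m) (h' m)) = haarE n (\<lambda>g. \<Prod>m\<in>S. g (f m) (\<tau> (h m)))"
      using t(2) by simp
    also have "\<dots> = haarE n (\<lambda>g. \<Prod>m\<in>S. g (f m) (h m))"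
      by (rule haarE_permute_columns[OF t(1), of "\<lambda>g. \<Prod>m\<in>S. g (f m) (h m)"])
    finally show ?thesis .
  qed
  then have "haarE n (\<lambda>g. \<Prod>m\<in>S. g (f m) (h m)) * real (card ?A)
      = (\<Sum>h'\<in>?A. haarE n (\<lambda>g. \<Prod>m\<in>S. g (f m) (h' m)))"
    by simp
  also have "\<dots> = haarE n (\<lambda>g. \<Sum>h'\<in>?A. \<Prod>m\<in>S. g (f m) (h' m))"
    by (rule haarE_sum[symmetric])
  also have "\<dots> = 1"
    by (rule haarE_const) (rule sum_monomials_kern[OF fin f ev])
  finally show ?thesis .
qed

text \<open>The fibres of \<open>f \<circ> \<gamma>\<close> are the preimages of the fibres of
  \<open>f\<close>, so \<gamma> carries the first kernel onto the second. Since taking images under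
  \<gamma> is injective on subsets of \<open>S\<close>, the two kernels agree exactly if \<gamma>
  fixes \<open>kern S f\<close>.\<close>

lemma kern_comp_bij:
  assumes "bij_betw \<gamma> S S"
  shows "kern S (\<lambda>x. f (\<gamma> x)) = kern S f \<longleftrightarrow> pimage \<gamma> (kern S f) = kern S f"
proof -
  have im: "\<gamma> ` S = S" and inj: "inj_on \<gamma> S" using assms by (auto simp: bij_betw_def)
  have "\<gamma> ` {t \<in> S. f (\<gamma> t) = f (\<gamma> s)} = {t \<in> S. f t = f (\<gamma> s)}" for s
    using im by auto
  then have "pimage \<gamma> (kern S (\<lambda>x. f (\<gamma> x))) = {{t \<in> S. f t = f (\<gamma> s)} |s. s \<in> S}"
    unfolding pimage_def kern_def by (auto; metis)
  also have "\<dots> = kern S f" unfolding kern_def using im by (auto; metis imageE imageI)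
  finally have eq: "pimage \<gamma> (kern S (\<lambda>x. f (\<gamma> x))) = kern S f" .
  have sub: "kern S F \<subseteq> Pow S" for F :: "'a \<Rightarrow> 'b" by (auto simp: kern_def)
  have img: "pimage \<gamma> q = (`) \<gamma> ` q" for q by (auto simp: pimage_def)
  have "inj_on ((`) \<gamma>) (Pow S)" using inj by (rule inj_on_image_Pow)
  then show ?thesis
    using eq sub inj_on_image_eq_iff[of "(`) \<gamma>" "Pow S"] unfolding img by metis
qed

text \<open>The sum has \<open>card A\<close> terms, all \<open>1 / card A\<close> or all
  \<open>0\<close>. The case \<open>A = {}\<close> is real: a partition with more than
  \<open>n\<close> blocks is not a kernel of any function into \<open>{1..n}\<close>.\<close>

lemma sum_haarE_fixed_kern:
  assumes fin: "finite S" and \<gamma>: "bij_betw \<gamma> S S"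
    and A: "A = {f \<in> PiE S (\<lambda>_. {1..n}). kern S f = q}"
  shows "(\<Sum>f\<in>A. haarE n (\<lambda>g. \<Prod>m\<in>S. g (f m) (f (\<gamma> m)))) =
    (if A \<noteq> {} \<and> pimage \<gamma> q = q \<and> (\<forall>B\<in>q. even (card B)) then 1 else 0)"
proof (cases "pimage \<gamma> q = q \<and> (\<forall>B\<in>q. even (card B))")
  case False
  have "haarE n (\<lambda>g. \<Prod>m\<in>S. g (f m) (f (\<gamma> m))) = 0" if "f \<in> A" for f
  proof -
    have q: "kern S f = q" using that A by auto
    show ?thesis
    proof (cases "pimage \<gamma> q = q")
      case True
      with False obtain B where "B \<in> kern S f" "odd (card B)" using q by blast
      then show ?thesis by (rule haarE_monomial_odd[OF fin])
    next
      case False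
      then have "kern S f \<noteq> kern S (\<lambda>m. f (\<gamma> m))" using kern_comp_bij[OF \<gamma>, of f] q by metis
      then show ?thesis by (rule haarE_monomial_kern_neq[OF fin])
    qed
  qed
  then show ?thesis using False by simp
next
  case True
  have finA: "finite A" unfolding A using fin
    by (intro finite_subset[OF _ finite_PiE[of S "\<lambda>_. {1..n}"]]) auto
  have "haarE n (\<lambda>g. \<Prod>m\<in>S. g (f m) (f (\<gamma> m))) = 1 / real (card A)" if "f \<in> A" for f
  proof -
    have q: "kern S f = q" and f: "f ` S \<subseteq> {1..n}" using that A by auto
    have f\<gamma>: "(\<lambda>m. f (\<gamma> m)) ` S \<subseteq> {1..n}" using f \<gamma> by (auto simp: bij_betw_def)
    have "kern S f = kern S (\<lambda>m. f (\<gamma> m))" using kern_comp_bij[OF \<gamma>, of f] q True by metis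
    from haarE_monomial_even[OF fin f f\<gamma> this] True
    have e: "haarE n (\<lambda>g. \<Prod>m\<in>S. g (f m) (f (\<gamma> m))) * real (card A) = 1"
      unfolding A q by blast
    then have "real (card A) \<noteq> 0" by (intro notI) simp
    then show ?thesis using e by (rule nonzero_eq_divide_eq[THEN iffD2])
  qed
  then have "(\<Sum>f\<in>A. haarE n (\<lambda>g. \<Prod>m\<in>S. g (f m) (f (\<gamma> m)))) = (\<Sum>f\<in>A. 1 / real (card A))"
    by simp
  also have "\<dots> = (if A \<noteq> {} then 1 else 0)" using finA by (auto simp: card_gt_0_iff)
  finally show ?thesis using True by simp
qed

section \<open>Cumulants\<close>

lemma cumulant_rec:
  assumes "finite I" "I \<noteq> {}"
  shows "cumulant E X I = E (\<lambda>\<omega>. \<Prod>i\<in>I. X i \<omega>)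
    - (\<Sum>\<pi>\<in>{\<pi>. partition_on I \<pi> \<and> \<pi> \<noteq> {I}}. \<Prod>B\<in>\<pi>. cumulant E X B)"
  using assms by (subst cumulant.simps) simp

text \<open>The moment-cumulant formula is triangular: the one-block partition contributes
  \<open>c I\<close> itself, every other partition only values of \<open>c\<close> on smaller sets.
  If it holds on all nonempty subsets it therefore determines \<open>c\<close>.\<close>

lemma cumulant_eqI:
  assumes fin: "finite I" and ne: "I \<noteq> {}"
    and moments: "\<And>J. \<lbrakk>J \<subseteq> I; J \<noteq> {}\<rbrakk> \<Longrightarrow>
      E (\<lambda>\<omega>. \<Prod>i\<in>J. X i \<omega>) = (\<Sum>\<pi>\<in>{\<pi>. partition_on J \<pi>}. \<Prod>B\<in>\<pi>. c B)"
  shows "cumulant E X I = c I"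
  using fin ne moments
proof (induction I rule: finite_psubset_induct)
  case (psubset I)
  let ?P = "{\<pi>. partition_on I \<pi> \<and> \<pi> \<noteq> {I}}"
  have "cumulant E X B = c B" if "\<pi> \<in> ?P" "B \<in> \<pi>" for \<pi> B
  proof (rule psubset.IH)
    show "B \<subset> I" using partition_block_psubset that by blast
    then show "E (\<lambda>\<omega>. \<Prod>i\<in>J. X i \<omega>) = (\<Sum>\<pi>\<in>{\<pi>. partition_on J \<pi>}. \<Prod>B\<in>\<pi>. c B)"
      if "J \<subseteq> B" "J \<noteq> {}" for J
      using psubset.prems(2) that by blast
    show "B \<noteq> {}" using that partition_onD3 by blast
  qed
  then have "(\<Sum>\<pi>\<in>?P. \<Prod>B\<in>\<pi>. cumulant E X B) = (\<Sum>\<pi>\<in>?P. \<Prod>B\<in>\<pi>. c B)"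
    by (intro sum.cong prod.cong) auto
  moreover have "{\<pi>. partition_on I \<pi>} = insert {I} ?P"
    using partition_on_space[OF psubset.prems(1)] by auto
  moreover have "finite ?P"
    by (rule finite_subset[OF _ finitely_many_partition_on[OF psubset.hyps(1)]]) auto
  ultimately show ?case
    using psubset.prems(2)[OF subset_refl psubset.prems(1)]
    by (simp add: cumulant_rec[OF psubset.hyps(1) psubset.prems(1)])
qed

text \<open>Every partition of a set of odd total weight has a block of odd weight, whose cumulant
  vanishes by induction. In this way nothing has to be known about the moments of even
  weight.\<close>

lemma cumulant_odd:
  fixes w :: "nat \<Rightarrow> nat"
  assumes fin: "finite I" and odd: "odd (\<Sum>i\<in>I. w i)"
    and moments: "\<And>J. \<lbrakk>J \<subseteq> I; odd (\<Sum>i\<in>J. w i)\<rbrakk> \<Longrightarrow> E (\<lambda>\<omega>. \<Prod>i\<in>J. X i \<omega>) = 0"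
  shows "cumulant E X I = 0"
  using fin odd moments
proof (induction I rule: finite_psubset_induct)
  case (psubset I)
  let ?P = "{\<pi>. partition_on I \<pi> \<and> \<pi> \<noteq> {I}}"
  have "(\<Prod>B\<in>\<pi>. cumulant E X B) = 0" if pi: "\<pi> \<in> ?P" for \<pi>
  proof -
    have p: "partition_on I \<pi>" using pi by blast
    have "(\<Sum>i\<in>I. w i) = (\<Sum>B\<in>\<pi>. \<Sum>i\<in>B. w i)" by (rule sum.partition[OF psubset.hyps(1) p])
    then have "\<not> (\<forall>B\<in>\<pi>. even (\<Sum>i\<in>B. w i))" using psubset.prems(1) by (metis dvd_sum)
    then obtain B where B: "B \<in> \<pi>" "odd (\<Sum>i\<in>B. w i)" by blast
    have sub: "B \<subset> I" using partition_block_psubset pi B by blast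
    have "cumulant E X B = 0"
      by (rule psubset.IH[OF sub B(2)]) (use sub psubset.prems(2) in blast)
    then show ?thesis using B finite_elements[OF psubset.hyps(1) p] by (auto simp: prod_zero_iff)
  qed
  moreover have "I \<noteq> {}" using psubset.prems(1) by auto
  ultimately show ?case
    using psubset.prems(2)[OF subset_refl psubset.prems(1)]
    by (simp add: cumulant_rec[OF psubset.hyps(1)])
qed

section \<open>Connected components\<close>

text \<open>The cycles of \<gamma> stripped of their cyclic structure: \<open>U\<close> indexes them
  and \<open>C i\<close> is the set of points of the \<open>i\<close>-th one. Connectedness depends
  on nothing more.\<close>

locale block_family =
  fixes C :: "'i \<Rightarrow> 'a set" and U :: "'i set"
  assumes fin_U: "finite U"
    and fin_C: "i \<in> U \<Longrightarrow> finite (C i)"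
    and C_ne: "i \<in> U \<Longrightarrow> C i \<noteq> {}"
    and C_disj: "\<lbrakk>i \<in> U; j \<in> U; x \<in> C i; x \<in> C j\<rbrakk> \<Longrightarrow> i = j"
begin

definition SS :: "'i set \<Rightarrow> 'a set" where
  "SS I = (\<Union>i\<in>I. C i)"

text \<open>The saturated index sets, which are the unions of connected components: no block of
  \<open>q\<close> leads from a cycle in \<open>J\<close> to a cycle outside
  \<open>J\<close>.\<close>

definition sat :: "'i set \<Rightarrow> 'a set set \<Rightarrow> 'i set set" where
  "sat I q = {J. J \<subseteq> I \<and> (\<forall>b\<in>q. b \<subseteq> SS J \<or> b \<inter> SS J = {})}"

text \<open>The component of \<open>i\<close> as the least saturated set containing it. For
  \<open>i \<in> I\<close> and \<open>q\<close> a partition of \<open>SS I\<close> the set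
  \<open>I\<close> is itself a candidate, so the intersection is not over the empty family.\<close>

definition atom :: "'i set \<Rightarrow> 'a set set \<Rightarrow> 'i \<Rightarrow> 'i set" where
  "atom I q i = \<Inter>{J \<in> sat I q. i \<in> J}"

lemma finite_SS: "I \<subseteq> U \<Longrightarrow> finite (SS I)"
  unfolding SS_def using fin_U fin_C finite_subset by blast

lemma in_SS_iff: "\<lbrakk>J \<subseteq> U; i \<in> U; x \<in> C i\<rbrakk> \<Longrightarrow> x \<in> SS J \<longleftrightarrow> i \<in> J"
  unfolding SS_def using C_disj by blast

lemma SS_mono: "J \<subseteq> I \<Longrightarrow> SS J \<subseteq> SS I"
  unfolding SS_def by blast

lemma SS_disjoint: "\<lbrakk>J \<subseteq> U; K \<subseteq> U; J \<inter> K = {}\<rbrakk> \<Longrightarrow> SS J \<inter> SS K = {}"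
  unfolding SS_def using C_disj by blast

lemma SS_Diff: "\<lbrakk>J \<subseteq> U; K \<subseteq> U\<rbrakk> \<Longrightarrow> SS (J - K) = SS J - SS K"
  unfolding SS_def using C_disj by blast

lemma sat_Diff:
  assumes I: "I \<subseteq> U" and J: "J \<in> sat I q" and K: "K \<in> sat I q"
  shows "J - K \<in> sat I q"
proof -
  have eq: "SS (J - K) = SS J - SS K" by (rule SS_Diff) (use I J K in \<open>auto simp: sat_def\<close>)
  have "b \<subseteq> SS (J - K) \<or> b \<inter> SS (J - K) = {}" if "b \<in> q" for b
  proof -
    have "b \<subseteq> SS J \<or> b \<inter> SS J = {}" "b \<subseteq> SS K \<or> b \<inter> SS K = {}"
      using J K that by (simp_all add: sat_def)
    then show ?thesis unfolding eq by blast
  qed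
  then show ?thesis using J by (auto simp: sat_def)
qed

text \<open>A block that meets the intersection meets every saturated \<open>J\<close> containing
  \<open>i\<close>, hence lies inside each of them and so inside the intersection.\<close>

lemma atom_in_sat:
  assumes I: "I \<subseteq> U" and q: "partition_on (SS I) q" and i: "i \<in> I"
  shows "atom I q i \<in> sat I q"
proof -
  let ?A = "atom I q i"
  have I_sat: "I \<in> sat I q" using partition_onD1[OF q] by (auto simp: sat_def)
  then have sub: "?A \<subseteq> I" using i by (auto simp: atom_def)
  have "b \<subseteq> SS ?A" if b: "b \<in> q" and "b \<inter> SS ?A \<noteq> {}" for b
  proof
    fix x assume x: "x \<in> b"
    then have "x \<in> SS I" using b partition_onD1[OF q] by blast
    then obtain j where j: "j \<in> I" "x \<in> C j" by (auto simp: SS_def)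
    have "j \<in> J" if J: "J \<in> sat I q" "i \<in> J" for J
    proof -
      have "?A \<subseteq> J" using J by (auto simp: atom_def)
      then have "b \<inter> SS J \<noteq> {}" using \<open>b \<inter> SS ?A \<noteq> {}\<close> SS_mono by blast
      then have "x \<in> SS J" using J b x by (auto simp: sat_def)
      moreover have "J \<subseteq> U" using J I by (auto simp: sat_def)
      ultimately show ?thesis using in_SS_iff j I by blast
    qed
    then have "j \<in> ?A" by (auto simp: atom_def)
    then show "x \<in> SS ?A" using j by (auto simp: SS_def)
  qed
  then show ?thesis using sub by (auto simp: sat_def)
qed

lemma mem_atom: "i \<in> atom I q i"
  by (simp add: atom_def)

lemma atom_least: "\<lbrakk>J \<in> sat I q; i \<in> J\<rbrakk> \<Longrightarrow> atom I q i \<subseteq> J"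
  by (auto simp: atom_def)

text \<open>One inclusion is minimality. For the other, if \<open>i\<close> were missing from the
  atom of \<open>j\<close>, then removing that atom from the atom of \<open>i\<close> would leave a
  saturated set that contains \<open>i\<close> but not \<open>j\<close>, against minimality.\<close>

lemma atom_eq:
  assumes I: "I \<subseteq> U" and q: "partition_on (SS I) q" and i: "i \<in> I" and j: "j \<in> atom I q i"
  shows "atom I q j = atom I q i"
proof
  have si: "atom I q i \<in> sat I q" by (rule atom_in_sat[OF I q i])
  then have jI: "j \<in> I" using j by (auto simp: sat_def)
  have sj: "atom I q j \<in> sat I q" by (rule atom_in_sat[OF I q jI])
  show "atom I q j \<subseteq> atom I q i" by (rule atom_least[OF si j])
  have "i \<in> atom I q j"
  proof (rule ccontr)
    assume "i \<notin> atom I q j"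
    then have "atom I q i \<subseteq> atom I q i - atom I q j"
      by (intro atom_least sat_Diff[OF I si sj]) (simp add: mem_atom)
    then show False using j mem_atom[of j] by blast
  qed
  then show "atom I q i \<subseteq> atom I q j" by (rule atom_least[OF sj])
qed

lemma partition_on_atoms:
  assumes I: "I \<subseteq> U" and q: "partition_on (SS I) q"
  shows "partition_on I (atom I q ` I)"
proof (rule partition_onI)
  show "\<Union>(atom I q ` I) = I"
  proof
    show "\<Union>(atom I q ` I) \<subseteq> I" using atom_in_sat[OF I q] unfolding sat_def by blast
  qed (use mem_atom in blast)
  show "{} \<notin> atom I q ` I" using mem_atom by (metis empty_iff imageE)
  show "disjnt B D" if BD: "B \<in> atom I q ` I" "D \<in> atom I q ` I" "B \<noteq> D" for B D
  proof (rule ccontr)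
    assume "\<not> disjnt B D"
    then obtain k where k: "k \<in> B" "k \<in> D" by (auto simp: disjnt_def)
    obtain i j where ij: "i \<in> I" "j \<in> I" "B = atom I q i" "D = atom I q j" using BD by blast
    have "atom I q k = B" unfolding ij(3) by (rule atom_eq[OF I q ij(1)]) (use k ij in simp)
    moreover have "atom I q k = D" unfolding ij(4) by (rule atom_eq[OF I q ij(2)]) (use k ij in simp)
    ultimately show False using BD(3) by simp
  qed
qed

text \<open>Recognizes the components as the minimal nonempty saturated sets. In this form the
  condition can be tested on each block of \<pi> separately, which is what a partition assembled
  from pieces requires.\<close>

lemma atoms_eq_iff:
  assumes I: "I \<subseteq> U" and q: "partition_on (SS I) q" and \<pi>: "partition_on I \<pi>"
  shows "atom I q ` I = \<pi> \<longleftrightarrow>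
    (\<forall>B\<in>\<pi>. B \<in> sat I q \<and> (\<forall>J\<in>sat I q. J \<subseteq> B \<longrightarrow> J = {} \<or> J = B))" (is "?l \<longleftrightarrow> ?r")
proof
  assume l: ?l
  show ?r
  proof (intro ballI conjI impI)
    fix B assume "B \<in> \<pi>"
    then obtain i where i: "i \<in> I" "B = atom I q i" using l by blast
    show "B \<in> sat I q" unfolding i(2) by (rule atom_in_sat[OF I q i(1)])
    fix J assume J: "J \<in> sat I q" "J \<subseteq> B"
    have "J = B" if "j \<in> J" for j
    proof -
      have "atom I q j = B" unfolding i(2) by (rule atom_eq[OF I q i(1)]) (use i J that in blast)
      then show ?thesis using atom_least[OF J(1) that] J(2) by blast
    qed
    then show "J = {} \<or> J = B" by blast
  qed
next
  assume r: ?r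
  have "\<pi> \<subseteq> atom I q ` I"
  proof
    fix B assume B: "B \<in> \<pi>"
    then obtain i where i: "i \<in> B" using partition_onD3[OF \<pi>] by (metis ex_in_conv)
    then have iI: "i \<in> I" using B partition_onD1[OF \<pi>] by blast
    have Bs: "B \<in> sat I q" and Bm: "\<forall>J\<in>sat I q. J \<subseteq> B \<longrightarrow> J = {} \<or> J = B"
      using bspec[OF r B] by simp_all
    have "atom I q i \<subseteq> B" by (rule atom_least[OF Bs i])
    then have "atom I q i = {} \<or> atom I q i = B" using bspec[OF Bm atom_in_sat[OF I q iI]] by simp
    then have "atom I q i = B" using mem_atom[of i I q] by auto
    then show "B \<in> atom I q ` I" using iI by blast
  qed
  then have "\<pi> = atom I q ` I" by (rule partition_on_subset_eq[OF \<pi> partition_on_atoms[OF I q]])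
  then show ?l by simp
qed

text \<open>Gluing: the pieces live on disjoint sets of points, so the union remembers them (second
  claim), and below a single \<open>B\<close> saturation is decided by the piece \<open>F B\<close>
  alone (last claim).\<close>

lemma partition_on_SS_Union:
  assumes I: "I \<subseteq> U" and \<pi>: "partition_on I \<pi>"
    and F: "\<And>B. B \<in> \<pi> \<Longrightarrow> partition_on (SS B) (F B)"
  shows "partition_on (SS I) (\<Union>B\<in>\<pi>. F B)"
    and "B \<in> \<pi> \<Longrightarrow> {b \<in> (\<Union>B\<in>\<pi>. F B). b \<subseteq> SS B} = F B"
    and "B \<in> \<pi> \<Longrightarrow> B \<in> sat I (\<Union>B\<in>\<pi>. F B)"
    and "\<lbrakk>B \<in> \<pi>; J \<subseteq> B\<rbrakk> \<Longrightarrow> J \<in> sat I (\<Union>B\<in>\<pi>. F B) \<longleftrightarrow> J \<in> sat B (F B)"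
proof -
  have BI: "B \<subseteq> I" if "B \<in> \<pi>" for B using that partition_onD1[OF \<pi>] by blast
  have bS: "b \<subseteq> SS B" and bne: "b \<noteq> {}" if "B \<in> \<pi>" "b \<in> F B" for b B
    using partition_onD1[OF F[OF that(1)]] partition_onD3[OF F[OF that(1)]] that by blast+
  have dis: "SS B \<inter> SS D = {}" if "B \<in> \<pi>" "D \<in> \<pi>" "B \<noteq> D" for B D
    using SS_disjoint[of B D] disjointD[OF partition_onD2[OF \<pi>] that] BI that I by blast
  show "partition_on (SS I) (\<Union>B\<in>\<pi>. F B)"
  proof (rule partition_onI)
    have "\<Union>(\<Union>B\<in>\<pi>. F B) = (\<Union>B\<in>\<pi>. SS B)" using partition_onD1[OF F] by blast
    also have "\<dots> = SS I" unfolding SS_def using partition_onD1[OF \<pi>] by blast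
    finally show "\<Union>(\<Union>B\<in>\<pi>. F B) = SS I" .
    show "{} \<notin> (\<Union>B\<in>\<pi>. F B)" using bne by blast
    fix b d assume bd: "b \<in> (\<Union>B\<in>\<pi>. F B)" "d \<in> (\<Union>B\<in>\<pi>. F B)" "b \<noteq> d"
    then obtain B D where BD: "B \<in> \<pi>" "b \<in> F B" "D \<in> \<pi>" "d \<in> F D" by blast
    show "disjnt b d"
    proof (cases "B = D")
      case True
      then show ?thesis
        using disjointD[OF partition_onD2[OF F[OF BD(1)]], of b d] BD bd by (simp add: disjnt_def)
    next
      case False
      then show ?thesis using dis[of B D] bS BD unfolding disjnt_def by blast
    qed
  qed
  show "{b \<in> (\<Union>B\<in>\<pi>. F B). b \<subseteq> SS B} = F B" if B: "B \<in> \<pi>" for B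
  proof (intro equalityI subsetI)
    fix b assume "b \<in> {b \<in> (\<Union>B\<in>\<pi>. F B). b \<subseteq> SS B}"
    then obtain D where D: "D \<in> \<pi>" "b \<in> F D" "b \<subseteq> SS B" by blast
    then have "D = B" using dis[of D B] B bS[of D b] bne[of D b] by blast
    then show "b \<in> F B" using D by simp
  qed (use B bS in auto)
  show "B \<in> sat I (\<Union>B\<in>\<pi>. F B)" if B: "B \<in> \<pi>" for B
    unfolding sat_def using BI[OF B] bS dis[OF _ B] by blast
  show "J \<in> sat I (\<Union>B\<in>\<pi>. F B) \<longleftrightarrow> J \<in> sat B (F B)" if B: "B \<in> \<pi>" and J: "J \<subseteq> B"
  proof -
    have other: "b \<inter> SS J = {}" if "D \<in> \<pi>" "b \<in> F D" "D \<noteq> B" for b D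
      using dis[OF that(1) B that(3)] bS[OF that(1,2)] SS_mono[OF J] by blast
    have "(\<forall>b\<in>\<Union>B\<in>\<pi>. F B. b \<subseteq> SS J \<or> b \<inter> SS J = {}) \<longleftrightarrow>
        (\<forall>b\<in>F B. b \<subseteq> SS J \<or> b \<inter> SS J = {})" (is "?l \<longleftrightarrow> ?r")
    proof
      assume ?l
      then show ?r using B by simp
    next
      assume r: ?r
      show ?l
      proof
        fix b assume "b \<in> (\<Union>B\<in>\<pi>. F B)"
        then obtain D where D: "D \<in> \<pi>" "b \<in> F D" by blast
        show "b \<subseteq> SS J \<or> b \<inter> SS J = {}"
          using r D other[OF D] by (cases "D = B") simp_all
      qed
    qed
    moreover have "J \<subseteq> I" using J BI[OF B] by simp
    ultimately show ?thesis unfolding sat_def using J by simp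
  qed
qed

text \<open>The converse of gluing: when no block of \<open>q\<close> crosses the boundary of any
  \<open>SS B\<close>, each block lies in exactly one piece.\<close>

lemma partition_on_SS_split:
  assumes I: "I \<subseteq> U" and \<pi>: "partition_on I \<pi>" and q: "partition_on (SS I) q"
    and s: "\<And>B. B \<in> \<pi> \<Longrightarrow> B \<in> sat I q"
  shows "B \<in> \<pi> \<Longrightarrow> partition_on (SS B) {b \<in> q. b \<subseteq> SS B}"
    and "(\<Union>B\<in>\<pi>. {b \<in> q. b \<subseteq> SS B}) = q"
proof -
  have SI: "SS I = (\<Union>B\<in>\<pi>. SS B)" unfolding SS_def using partition_onD1[OF \<pi>] by blast
  have Uq: "\<Union>q = SS I" using partition_onD1[OF q] by simp
  show "partition_on (SS B) {b \<in> q. b \<subseteq> SS B}" if B: "B \<in> \<pi>" for B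
  proof (rule partition_onI)
    show "\<Union>{b \<in> q. b \<subseteq> SS B} = SS B"
    proof (intro equalityI subsetI)
      fix x assume x: "x \<in> SS B"
      then obtain b where b: "b \<in> q" "x \<in> b" using SI Uq B by blast
      then have "b \<subseteq> SS B" using s[OF B] x unfolding sat_def by blast
      then show "x \<in> \<Union>{b \<in> q. b \<subseteq> SS B}" using b by blast
    qed blast
  qed (use q in \<open>auto simp: partition_on_def disjoint_def disjnt_def\<close>)
  show "(\<Union>B\<in>\<pi>. {b \<in> q. b \<subseteq> SS B}) = q"
  proof (intro equalityI subsetI)
    fix b assume b: "b \<in> q"
    then obtain x where x: "x \<in> b" using partition_onD3[OF q] by (metis ex_in_conv)
    then obtain B where B: "B \<in> \<pi>" "x \<in> SS B" using SI Uq b by blast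
    then have "b \<subseteq> SS B" using s[OF B(1)] b x unfolding sat_def by blast
    then show "b \<in> (\<Union>B\<in>\<pi>. {b \<in> q. b \<subseteq> SS B})" using B b by blast
  qed blast
qed

text \<open>Stated by saturated sets instead of the join, so that it is literally the minimality
  condition in \<open>atoms_eq_iff\<close> for a single component.\<close>

definition connected_on :: "'i set \<Rightarrow> 'a set set \<Rightarrow> bool" where
  "connected_on I q \<longleftrightarrow> (\<forall>J\<in>sat I q. J = {} \<or> J = I)"

text \<open>A partition of \<open>SS I\<close> is the same as a partition of \<open>I\<close> (its connected components) together
  with a connected partition of \<open>SS B\<close> for every component \<open>B\<close>.\<close>

lemma card_partitions_by_components:
  assumes I: "I \<subseteq> U"
    and local: "\<And>\<pi> F. \<lbrakk>partition_on I \<pi>; \<And>B. B \<in> \<pi> \<Longrightarrow> partition_on (SS B) (F B)\<rbrakk> \<Longrightarrow>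
      Good I (\<Union>B\<in>\<pi>. F B) \<longleftrightarrow> (\<forall>B\<in>\<pi>. Good B (F B))"
  shows "card {q. partition_on (SS I) q \<and> Good I q} =
    (\<Sum>\<pi>\<in>{\<pi>. partition_on I \<pi>}. \<Prod>B\<in>\<pi>. card {q. partition_on (SS B) q \<and> Good B q \<and> connected_on B q})"
proof -
  let ?Q = "{q. partition_on (SS I) q \<and> Good I q}"
  let ?K = "\<lambda>B. {q. partition_on (SS B) q \<and> Good B q \<and> connected_on B q}"
  \<comment> \<open>The partitions whose set of components is exactly \<pi>. These classes split
    \<open>?Q\<close>, and gluing identifies each of them with the product of the sets
    \<open>?K B\<close>.\<close>
  let ?R = "\<lambda>\<pi>. {q \<in> ?Q. atom I q ` I = \<pi>}"
  have finI: "finite I" using I fin_U finite_subset by blast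
  have finQ: "finite ?Q"
    by (rule finite_subset[OF _ finitely_many_partition_on[OF finite_SS[OF I]]]) auto
  have cardR: "card (?R \<pi>) = (\<Prod>B\<in>\<pi>. card (?K B))" if \<pi>: "partition_on I \<pi>" for \<pi>
  proof -
    have "bij_betw (\<lambda>F. \<Union>B\<in>\<pi>. F B) (PiE \<pi> ?K) (?R \<pi>)"
    proof (rule bij_betw_byWitness[where f' = "\<lambda>q. restrict (\<lambda>B. {b \<in> q. b \<subseteq> SS B}) \<pi>"])
      have part: "partition_on (SS B) (F B)" if "F \<in> PiE \<pi> ?K" "B \<in> \<pi>" for F B
        using PiE_mem[OF that] by simp
      show "\<forall>F\<in>PiE \<pi> ?K. restrict (\<lambda>B. {b \<in> (\<Union>B\<in>\<pi>. F B). b \<subseteq> SS B}) \<pi> = F"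
      proof
        fix F assume F: "F \<in> PiE \<pi> ?K"
        show "restrict (\<lambda>B. {b \<in> (\<Union>B\<in>\<pi>. F B). b \<subseteq> SS B}) \<pi> = F"
        proof (rule extensionalityI[of _ \<pi>])
          show "F \<in> extensional \<pi>" using F by (simp add: PiE_def)
          fix B assume B: "B \<in> \<pi>"
          then show "restrict (\<lambda>B. {b \<in> (\<Union>B\<in>\<pi>. F B). b \<subseteq> SS B}) \<pi> B = F B"
            using partition_on_SS_Union(2)[OF I \<pi> part[OF F] B] by simp
        qed auto
      qed
      have sat_R: "B \<in> sat I q" "\<And>J. \<lbrakk>J \<in> sat I q; J \<subseteq> B\<rbrakk> \<Longrightarrow> J = {} \<or> J = B"
        if "q \<in> ?R \<pi>" "B \<in> \<pi>" for q B
        using that atoms_eq_iff[OF I _ \<pi>, of q] by blast+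
      show "\<forall>q\<in>?R \<pi>. (\<Union>B\<in>\<pi>. restrict (\<lambda>B. {b \<in> q. b \<subseteq> SS B}) \<pi> B) = q"
      proof
        fix q assume q: "q \<in> ?R \<pi>"
        have "(\<Union>B\<in>\<pi>. {b \<in> q. b \<subseteq> SS B}) = q"
          by (rule partition_on_SS_split(2)[OF I \<pi>]) (use q sat_R in blast)+
        then show "(\<Union>B\<in>\<pi>. restrict (\<lambda>B. {b \<in> q. b \<subseteq> SS B}) \<pi> B) = q" by simp
      qed
      show "(\<lambda>F. \<Union>B\<in>\<pi>. F B) ` PiE \<pi> ?K \<subseteq> ?R \<pi>"
      proof (rule image_subsetI)
        fix F assume F: "F \<in> PiE \<pi> ?K"
        have u: "partition_on (SS I) (\<Union>B\<in>\<pi>. F B)"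
          by (rule partition_on_SS_Union(1)[OF I \<pi>]) (rule part[OF F])
        have "Good I (\<Union>B\<in>\<pi>. F B)"
          using local[OF \<pi> part[OF F]] PiE_mem[OF F] by blast
        moreover have "atom I (\<Union>B\<in>\<pi>. F B) ` I = \<pi>"
          unfolding atoms_eq_iff[OF I u \<pi>]
        proof (intro ballI conjI impI)
          fix B assume B: "B \<in> \<pi>"
          show "B \<in> sat I (\<Union>B\<in>\<pi>. F B)" 
            by (rule partition_on_SS_Union(3)[OF I \<pi> _ B]) (rule part[OF F])
          fix J assume "J \<in> sat I (\<Union>B\<in>\<pi>. F B)" "J \<subseteq> B"
          then have "J \<in> sat B (F B)"
            using partition_on_SS_Union(4)[OF I \<pi> _ B, of F J] part[OF F] by blast
          then show "J = {} \<or> J = B" using PiE_mem[OF F B] by (simp add: connected_on_def)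
        qed
        ultimately show "(\<Union>B\<in>\<pi>. F B) \<in> ?R \<pi>" using u by blast
      qed
      show "(\<lambda>q. restrict (\<lambda>B. {b \<in> q. b \<subseteq> SS B}) \<pi>) ` ?R \<pi> \<subseteq> PiE \<pi> ?K"
      proof (rule image_subsetI)
        fix q assume q: "q \<in> ?R \<pi>"
        let ?F = "\<lambda>B. {b \<in> q. b \<subseteq> SS B}"
        have qp: "partition_on (SS I) q" and qG: "Good I q" using q by auto
        have p: "partition_on (SS B) (?F B)" if "B \<in> \<pi>" for B
          by (rule partition_on_SS_split(1)[OF I \<pi> qp sat_R(1)[OF q] that])
        have un: "(\<Union>B\<in>\<pi>. ?F B) = q" by (rule partition_on_SS_split(2)[OF I \<pi> qp sat_R(1)[OF q]])
        have "\<forall>B\<in>\<pi>. Good B (?F B)" using local[OF \<pi> p] qG unfolding un by blast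
        moreover have "connected_on B (?F B)" if B: "B \<in> \<pi>" for B
          unfolding connected_on_def
        proof
          fix J assume J: "J \<in> sat B (?F B)"
          then have "J \<subseteq> B" by (simp add: sat_def)
          moreover have "J \<in> sat I q"
            using partition_on_SS_Union(4)[OF I \<pi> p B \<open>J \<subseteq> B\<close>] J unfolding un by blast
          ultimately show "J = {} \<or> J = B" using sat_R(2)[OF q B] by blast
        qed
        ultimately show "restrict ?F \<pi> \<in> PiE \<pi> ?K" using p by simp
      qed
    qed
    then have "card (?R \<pi>) = card (PiE \<pi> ?K)" by (rule bij_betw_same_card[symmetric])
    also have "\<dots> = (\<Prod>B\<in>\<pi>. card (?K B))" by (rule card_PiE[OF finite_elements[OF finI \<pi>]])
    finally show ?thesis .
  qed
  have "?Q = (\<Union>\<pi>\<in>{\<pi>. partition_on I \<pi>}. ?R \<pi>)"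
    using partition_on_atoms[OF I] by blast
  also have "card \<dots> = (\<Sum>\<pi>\<in>{\<pi>. partition_on I \<pi>}. card (?R \<pi>))"
  proof (rule card_UN_disjoint[OF finitely_many_partition_on[OF finI]])
    show "\<forall>\<pi>\<in>{\<pi>. partition_on I \<pi>}. finite (?R \<pi>)"
      by (intro ballI finite_subset[OF _ finQ]) blast
  qed blast
  also have "\<dots> = (\<Sum>\<pi>\<in>{\<pi>. partition_on I \<pi>}. \<Prod>B\<in>\<pi>. card (?K B))"
    by (rule sum.cong[OF refl]) (rule cardR, rule CollectD)
  finally show ?thesis .
qed

text \<open>A class of the join is a union of cycles that no block crosses, so the cycles inside it
  form a nonempty saturated set; if \<open>q\<close> is connected, this is all of \<open>U\<close>.
  Conversely, a chain of blocks and cycles that starts in a saturated set never leaves it.\<close>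

lemma connected_on_iff_pjoin:
  assumes q: "partition_on (SS U) q" and ne: "U \<noteq> {}"
  shows "connected_on U q \<longleftrightarrow> pjoin q (C ` U) = {SS U}"
proof -
  define R where "R = {(x, y). \<exists>B\<in>q \<union> C ` U. x \<in> B \<and> y \<in> B}"
  have Uq: "\<Union>q = SS U" using partition_onD1[OF q] by simp
  have j: "pjoin q (C ` U) = {R\<^sup>* `` {x} | x. x \<in> SS U}"
    by (simp add: pjoin_def R_def Uq)
  have RS: "y \<in> SS U" if "(x, y) \<in> R" for x y using that Uq by (auto simp: R_def SS_def)
  have RsS: "y \<in> SS U" if "(x, y) \<in> R\<^sup>*" "x \<in> SS U" for x y
    using that by (induction) (auto intro: RS)
  show ?thesis
  proof
    assume con: "connected_on U q"
    have "R\<^sup>* `` {x} = SS U" if x: "x \<in> SS U" for x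
    proof -
      let ?T = "R\<^sup>* `` {x}"
      have TS: "?T \<subseteq> SS U" using RsS x by blast
      have closed: "B \<subseteq> ?T" if B: "B \<in> q \<union> C ` U" "B \<inter> ?T \<noteq> {}" for B
      proof
        fix y assume y: "y \<in> B"
        obtain z where z: "z \<in> B" "(x, z) \<in> R\<^sup>*" using B(2) by blast
        have "(z, y) \<in> R" unfolding R_def using B(1) y z(1) by blast
        with z(2) have "(x, y) \<in> R\<^sup>*" by (rule rtrancl.rtrancl_into_rtrancl)
        then show "y \<in> ?T" by simp
      qed
      define J where "J = {i \<in> U. C i \<subseteq> ?T}"
      have TJ: "SS J = ?T"
      proof
        show "SS J \<subseteq> ?T" unfolding SS_def J_def by blast
        show "?T \<subseteq> SS J"
        proof
          fix y assume y: "y \<in> ?T"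
          then obtain i where i: "i \<in> U" "y \<in> C i" using TS unfolding SS_def by blast
          then have "C i \<subseteq> ?T" using closed[of "C i"] y by blast
          then show "y \<in> SS J" using i unfolding SS_def J_def by blast
        qed
      qed
      have "b \<subseteq> SS J \<or> b \<inter> SS J = {}" if "b \<in> q" for b
      proof -
        have "b \<in> q \<union> C ` U" using that by simp
        from closed[OF this] show ?thesis unfolding TJ by argo
      qed
      then have "J \<in> sat U q" unfolding sat_def J_def by simp
      moreover have "x \<in> SS J" unfolding TJ by simp
      then have "J \<noteq> {}" by (auto simp: SS_def)
      ultimately have "J = U" using con unfolding connected_on_def by auto
      then show ?thesis using TJ by simp
    qed
    moreover have "SS U \<noteq> {}" using ne C_ne unfolding SS_def by blast
    ultimately show "pjoin q (C ` U) = {SS U}" unfolding j by blast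
  next
    assume jS: "pjoin q (C ` U) = {SS U}"
    show "connected_on U q"
      unfolding connected_on_def
    proof (intro ballI)
      fix J assume J: "J \<in> sat U q"
      show "J = {} \<or> J = U"
      proof (rule ccontr)
        assume "\<not> (J = {} \<or> J = U)"
        then obtain i k where ik: "i \<in> J" "k \<in> U" "k \<notin> J" using J unfolding sat_def by blast
        have JU: "J \<subseteq> U" using J unfolding sat_def by blast
        obtain x y where xy: "x \<in> C i" "y \<in> C k" using C_ne ik JU by blast
        have step: "z \<in> SS J" if w: "w \<in> SS J" "(w, z) \<in> R" for w z
        proof -
          obtain B where B: "B \<in> q \<union> C ` U" "w \<in> B" "z \<in> B" using w(2) unfolding R_def by blast
          show ?thesis
          proof (cases "B \<in> q")
            case True
            then show ?thesis using J B w(1) unfolding sat_def by blast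
          next
            case False
            then obtain l where l: "l \<in> U" "B = C l" using B by blast
            then have "l \<in> J" using in_SS_iff[OF JU l(1)] B(2) w(1) by blast
            then show ?thesis using l B unfolding SS_def by blast
          qed
        qed
        have x0: "x \<in> SS J" using xy ik unfolding SS_def by blast
        have all: "z \<in> SS J" if "(x, z) \<in> R\<^sup>*" for z
          using that by induction (use x0 step in blast)+
        have "x \<in> SS U" using x0 SS_mono[OF JU] by blast
        then have "R\<^sup>* `` {x} \<in> pjoin q (C ` U)" unfolding j by blast
        then have "R\<^sup>* `` {x} = SS U" unfolding jS by simp
        moreover have "y \<in> SS U" using xy ik unfolding SS_def by blast
        ultimately have "y \<in> SS J" using all by blast
        then show False using in_SS_iff[OF JU ik(2) xy(2)] ik(3) by blast
      qed
    qed
  qed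
qed

end

section \<open>The trace permutation\<close>

definition cyc :: "(nat \<Rightarrow> nat) \<Rightarrow> nat \<Rightarrow> nat set" where
  "cyc k i = {off k i + 1 .. off k i + k i}"

lemma gpart_eq: "gpart k r = cyc k ` {1..r}"
  by (auto simp: gpart_def cyc_def)

lemma off_less: "\<lbrakk>1 \<le> i; i < j\<rbrakk> \<Longrightarrow> off k i + k i \<le> off k j"
proof -
  assume ij: "1 \<le> i" "i < j"
  have "off k i + k i = (\<Sum>l\<in>{1..<Suc i}. k l)" using ij by (simp add: off_def)
  also have "\<dots> \<le> off k j" unfolding off_def using ij by (intro sum_mono2) auto
  finally show ?thesis .
qed

lemma cyc_disjoint:
  assumes "1 \<le> i" "1 \<le> j" "x \<in> cyc k i" "x \<in> cyc k j"
  shows "i = j"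
  using off_less[of i j k] off_less[of j i k] assms
  by (cases i j rule: linorder_cases) (auto simp: cyc_def)

lemma UN_cyc: "(\<Union>i\<in>{1..r}. cyc k i) = {1..ktot k r}"
proof (induction r)
  case (Suc r)
  have "off k (Suc r) = ktot k r" by (simp add: off_def ktot_def atLeastLessThanSuc_atLeastAtMost)
  moreover have "ktot k (Suc r) = ktot k r + k (Suc r)" by (simp add: ktot_def)
  moreover have "{1..Suc r} = insert (Suc r) {1..r}" by auto
  ultimately show ?case using Suc by (auto simp: cyc_def)
qed (simp add: ktot_def)

locale trace_cycles =
  fixes k :: "nat \<Rightarrow> nat" and r :: nat
  assumes k_pos: "i \<in> {1..r} \<Longrightarrow> k i \<ge> 1"
begin

sublocale block_family "cyc k" "{1..r}"
proof
  show "cyc k i \<noteq> {}" if "i \<in> {1..r}" for i using k_pos[OF that] by (auto simp: cyc_def)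
qed (use cyc_disjoint in \<open>auto simp: cyc_def\<close>)

lemma SS_all: "SS {1..r} = {1..ktot k r}"
  unfolding SS_def by (rule UN_cyc)

lemma card_SS: "I \<subseteq> {1..r} \<Longrightarrow> card (SS I) = (\<Sum>i\<in>I. k i)"
proof -
  assume I: "I \<subseteq> {1..r}"
  have "card (SS I) = (\<Sum>i\<in>I. card (cyc k i))" unfolding SS_def
  proof (rule card_UN_disjoint)
    show "finite I" using I finite_subset by blast
    show "\<forall>i\<in>I. finite (cyc k i)" by (simp add: cyc_def)
    show "\<forall>i\<in>I. \<forall>j\<in>I. i \<noteq> j \<longrightarrow> cyc k i \<inter> cyc k j = {}" using C_disj I by blast
  qed
  then show ?thesis by (simp add: cyc_def)
qed

text \<open>Every cycle is nonempty and therefore contains its own end point, so by disjointness a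
  point ends at most one cycle and the sum in \<open>gam\<close> has at most one nonzero term. At
  \<open>s = k i\<close> subtracting \<open>k i\<close> leads back to
  \<open>off k i + 1\<close>.\<close>

lemma gam_cyc:
  assumes i: "i \<in> {1..r}" and s: "s \<in> {1..k i}"
  shows "gam k r (off k i + s) = off k i + (if s = k i then 1 else s + 1)"
proof -
  have "(off k i + s = off k j + k j) \<longleftrightarrow> (j = i \<and> s = k i)" if j: "j \<in> {1..r}" for j
  proof
    assume eq: "off k i + s = off k j + k j"
    have "off k i + s \<in> cyc k i" using s by (simp add: cyc_def)
    moreover have "off k i + s \<in> cyc k j" using k_pos[OF j] by (simp add: cyc_def eq)
    ultimately have "j = i" using C_disj i j by blast
    then show "j = i \<and> s = k i" using eq by simp
  qed simp
  then have "(\<Sum>j\<in>{1..r}. if off k i + s = off k j + k j then k j else 0)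
      = (\<Sum>j\<in>{1..r}. if j = i then (if s = k i then k i else 0) else 0)"
    by (intro sum.cong refl) auto
  also have "\<dots> = (if s = k i then k i else 0)" using i by simp
  finally have "gam k r (off k i + s) = off k i + s + 1 - (if s = k i then k i else 0)"
    unfolding gam_def by simp
  then show ?thesis by simp
qed

lemma cyc_shift:
  assumes "m \<in> cyc k i"
  obtains s where "s \<in> {1..k i}" "m = off k i + s"
  using assms that[of "m - off k i"] by (auto simp: cyc_def)

lemma SS_cases:
  assumes "m \<in> SS I"
  obtains i s where "i \<in> I" "s \<in> {1..k i}" "m = off k i + s"
  using assms cyc_shift unfolding SS_def by blast

lemma shift_in_cyc: "s \<in> {1..k i} \<Longrightarrow> off k i + s \<in> cyc k i"
  by (simp add: cyc_def)

lemma shift_in_SS: "\<lbrakk>i \<in> I; s \<in> {1..k i}\<rbrakk> \<Longrightarrow> off k i + s \<in> SS I"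
  unfolding SS_def using shift_in_cyc by blast

lemma bij_betw_gam:
  assumes I: "I \<subseteq> {1..r}"
  shows "bij_betw (gam k r) (SS I) (SS I)"
proof -
  have mem: "(if s = k i then 1 else s + 1) \<in> {1..k i}" if "s \<in> {1..k i}" for s i
    using that by auto
  have sub: "gam k r ` SS I \<subseteq> SS I"
  proof (rule image_subsetI)
    fix m assume "m \<in> SS I"
    then obtain i s where is': "i \<in> I" "s \<in> {1..k i}" "m = off k i + s" by (rule SS_cases)
    then have "gam k r m = off k i + (if s = k i then 1 else s + 1)" using gam_cyc[of i s] I by blast
    then show "gam k r m \<in> SS I" using shift_in_SS[OF is'(1) mem[OF is'(2)]] by simp
  qed
  have inj: "inj_on (gam k r) (SS I)"
  proof (rule inj_onI)
    fix m m' assume m: "m \<in> SS I" "m' \<in> SS I" and eq: "gam k r m = gam k r m'"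
    obtain i s where is': "i \<in> I" "s \<in> {1..k i}" "m = off k i + s" using m(1) by (rule SS_cases)
    obtain j t where jt: "j \<in> I" "t \<in> {1..k j}" "m' = off k j + t" using m(2) by (rule SS_cases)
    have g: "gam k r m = off k i + (if s = k i then 1 else s + 1)"
      "gam k r m' = off k j + (if t = k j then 1 else t + 1)"
      using gam_cyc[of i s] gam_cyc[of j t] I is' jt by blast+
    have c: "gam k r m \<in> cyc k i" unfolding g(1) by (rule shift_in_cyc[OF mem[OF is'(2)]])
    have "gam k r m \<in> cyc k j" unfolding eq g(2) by (rule shift_in_cyc[OF mem[OF jt(2)]])
    then have ij: "i = j" using C_disj[OF _ _ c] I is'(1) jt(1) by blast
    then have nx: "(if s = k i then 1 else s + 1) = (if t = k i then 1 else t + 1)"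
      using g eq by simp
    have "1 \<le> s" "1 \<le> t" using is'(2) jt(2) by simp_all
    with nx have "s = t" by (cases "s = k i"; cases "t = k i"; simp)
    then show "m = m'" using is'(3) jt(3) ij by simp
  qed
  have "gam k r ` SS I = SS I" by (rule endo_inj_surj[OF finite_SS[OF I] sub inj])
  then show ?thesis using inj by (simp add: bij_betw_def)
qed

text \<open>Translates the constraint on a multi-index in \<open>Zfun\<close> into the restriction
  condition of the theorem, for a function defined on several cycles at once.\<close>

lemma restr_kern:
  assumes I: "I \<subseteq> {1..r}" and i: "i \<in> I"
  shows "restr k (kern (SS I) f) i = ker (k i) (\<lambda>s. f (off k i + s))"
proof -
  let ?S = "SS I" and ?o = "off k i"
  have CS: "cyc k i \<subseteq> ?S" unfolding SS_def using i by blast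
  have blk: "(\<lambda>m. m - ?o) ` ({t \<in> ?S. f t = f (?o + s)} \<inter> cyc k i)
      = {t \<in> {1..k i}. f (?o + t) = f (?o + s)}" for s
  proof (intro equalityI subsetI)
    fix t assume "t \<in> (\<lambda>m. m - ?o) ` ({t \<in> ?S. f t = f (?o + s)} \<inter> cyc k i)"
    then obtain m where m: "m \<in> cyc k i" "f m = f (?o + s)" "t = m - ?o" by blast
    obtain u where "u \<in> {1..k i}" "m = ?o + u" using m(1) by (rule cyc_shift)
    then show "t \<in> {t \<in> {1..k i}. f (?o + t) = f (?o + s)}" using m by simp
  next
    fix t assume t: "t \<in> {t \<in> {1..k i}. f (?o + t) = f (?o + s)}"
    then have "?o + t \<in> cyc k i" using shift_in_cyc[of t i] by blast
    then show "t \<in> (\<lambda>m. m - ?o) ` ({t \<in> ?S. f t = f (?o + s)} \<inter> cyc k i)"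
      using t CS by (intro image_eqI[of _ _ "?o + t"]) auto
  qed
  have "restr k (kern ?S f) i = {(\<lambda>m. m - ?o) ` (B \<inter> cyc k i) | B. B \<in> kern ?S f \<and> B \<inter> cyc k i \<noteq> {}}"
    unfolding restr_def cyc_def ..
  also have "\<dots> = {{t \<in> {1..k i}. f (?o + t) = f (?o + s)} | s. s \<in> {1..k i}}" (is "?L = ?R")
  proof (intro equalityI subsetI)
    fix D assume "D \<in> ?L"
    then obtain B where B: "B \<in> kern ?S f" "B \<inter> cyc k i \<noteq> {}" "D = (\<lambda>m. m - ?o) ` (B \<inter> cyc k i)"
      by blast
    obtain x where x: "x \<in> B" "x \<in> cyc k i" using B(2) by blast
    obtain s where s: "s \<in> {1..k i}" "x = ?o + s" using x(2) by (rule cyc_shift)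
    obtain y where y: "y \<in> ?S" "B = {t \<in> ?S. f t = f y}" using B(1) by (auto simp: kern_def)
    then have "B = {t \<in> ?S. f t = f (?o + s)}" using x s by simp
    then have "D = {t \<in> {1..k i}. f (?o + t) = f (?o + s)}" using B(3) blk by simp
    then show "D \<in> ?R" using s by blast
  next
    fix D assume "D \<in> ?R"
    then obtain s where s: "s \<in> {1..k i}" "D = {t \<in> {1..k i}. f (?o + t) = f (?o + s)}" by blast
    let ?B = "{t \<in> ?S. f t = f (?o + s)}"
    have c: "?o + s \<in> cyc k i" by (rule shift_in_cyc[OF s(1)])
    then have "?B \<in> kern ?S f" "?B \<inter> cyc k i \<noteq> {}" using CS by (auto simp: kern_def)
    moreover have "D = (\<lambda>m. m - ?o) ` (?B \<inter> cyc k i)" using s(2) blk by simp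
    ultimately show "D \<in> ?L" by blast
  qed
  also have "\<dots> = ker (k i) (\<lambda>s. f (?o + s))" by (simp add: ker_def)
  finally show ?thesis .
qed

section \<open>Moments\<close>

text \<open>Multiplying out gives a sum over families of multi-indices, one per cycle. Such a family
  is the same as a single function on \<open>SS I\<close>, and stepping cyclically through every
  multi-index becomes composition with \<gamma>.\<close>

lemma prod_Zfun:
  assumes I: "I \<subseteq> {1..r}"
  shows "(\<Prod>i\<in>I. Zfun n (k i) (\<sigma> i) g) =
    (\<Sum>f\<in>{f \<in> PiE (SS I) (\<lambda>_. {1..n}). \<forall>i\<in>I. restr k (kern (SS I) f) i = \<sigma> i}.
       \<Prod>m\<in>SS I. g (f m) (f (gam k r m)))"
proof -
  let ?nx = "\<lambda>i s. if s = k i then 1 else s + 1"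
  let ?A = "\<lambda>i. {f \<in> PiE {1..k i} (\<lambda>_. {1..n}). ker (k i) f = \<sigma> i}"
  let ?T = "{f \<in> PiE (SS I) (\<lambda>_. {1..n}). \<forall>i\<in>I. restr k (kern (SS I) f) i = \<sigma> i}"
  have finI: "finite I" using I finite_subset by blast
  have nx: "?nx i s \<in> {1..k i}" if "s \<in> {1..k i}" for i s using that by auto
  \<comment> \<open>The index of the cycle through \<open>m\<close>; subtracting the offset of that
    cycle then recovers the position within it.\<close>
  define blk where "blk m = (THE i. i \<in> {1..r} \<and> m \<in> cyc k i)" for m
  have blk: "blk (off k i + s) = i" if "i \<in> I" "s \<in> {1..k i}" for i s
    unfolding blk_def
    by (rule the_equality) (use that I shift_in_cyc C_disj in blast)+
  define join where "join F = restrict (\<lambda>m. F (blk m) (m - off k (blk m))) (SS I)"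
    for F :: "nat \<Rightarrow> nat \<Rightarrow> nat"
  define split where "split f = restrict (\<lambda>i. restrict (\<lambda>s. f (off k i + s)) {1..k i}) I"
    for f :: "nat \<Rightarrow> nat"
  have join_app: "join F (off k i + s) = F i s" if "i \<in> I" "s \<in> {1..k i}" for F i s
    using that blk[OF that] shift_in_SS[OF that] by (simp add: join_def)
  have split_app: "split f i s = f (off k i + s)" if "i \<in> I" "s \<in> {1..k i}" for f i s
    using that by (simp add: split_def)
  have finA: "finite (?A i)" for i
    by (rule finite_subset[OF _ finite_PiE[of "{1..k i}" "\<lambda>_. {1..n}"]]) auto
  have "(\<Prod>i\<in>I. Zfun n (k i) (\<sigma> i) g) =
      (\<Sum>F\<in>PiE I ?A. \<Prod>i\<in>I. \<Prod>s\<in>{1..k i}. g (F i s) (F i (?nx i s)))"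
    unfolding Zfun_def by (rule prod_sum_PiE) (use finI finA in auto)
  also have "\<dots> = (\<Sum>f\<in>?T. \<Prod>m\<in>SS I. g (f m) (f (gam k r m)))"
  proof (rule sum.reindex_bij_witness[where i = split and j = join])
    fix F assume F: "F \<in> PiE I ?A"
    show "split (join F) = F"
    proof (rule extensionalityI[of _ I])
      show "F \<in> extensional I" using F by (simp add: PiE_def)
      fix i assume i: "i \<in> I"
      have Fi: "F i \<in> ?A i" by (rule PiE_mem[OF F i])
      show "split (join F) i = F i"
      proof (rule extensionalityI[of _ "{1..k i}"])
        show "F i \<in> extensional {1..k i}" using Fi by (simp add: PiE_def)
        show "split (join F) i \<in> extensional {1..k i}" using i by (simp add: split_def)
        show "split (join F) i s = F i s" if "s \<in> {1..k i}" for s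
          using split_app[OF i that] join_app[OF i that] by simp
      qed
    qed (simp add: split_def)
    show "join F \<in> ?T"
    proof (intro CollectI conjI ballI)
      show "join F \<in> PiE (SS I) (\<lambda>_. {1..n})"
      proof (rule PiE_I)
        fix m assume "m \<in> SS I"
        then obtain i s where is': "i \<in> I" "s \<in> {1..k i}" "m = off k i + s" by (rule SS_cases)
        have "F i \<in> PiE {1..k i} (\<lambda>_. {1..n})" using PiE_mem[OF F is'(1)] by blast
        then show "join F m \<in> {1..n}" unfolding is'(3) join_app[OF is'(1,2)] using is'(2) by (rule PiE_mem)
      qed (simp add: join_def)
      fix i assume i: "i \<in> I"
      have "restr k (kern (SS I) (join F)) i = ker (k i) (\<lambda>s. join F (off k i + s))"
        by (rule restr_kern[OF I i])
      also have "\<dots> = ker (k i) (F i)"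
        unfolding ker_eq_kern by (rule kern_cong) (rule join_app[OF i])
      also have "\<dots> = \<sigma> i" using PiE_mem[OF F i] by blast
      finally show "restr k (kern (SS I) (join F)) i = \<sigma> i" .
    qed
    have "(\<Prod>m\<in>SS I. g (join F m) (join F (gam k r m)))
        = (\<Prod>i\<in>I. \<Prod>m\<in>cyc k i. g (join F m) (join F (gam k r m)))"
      unfolding SS_def
    proof (rule prod.UNION_disjoint[OF finI])
      show "\<forall>i\<in>I. finite (cyc k i)" by (simp add: cyc_def)
      show "\<forall>i\<in>I. \<forall>j\<in>I. i \<noteq> j \<longrightarrow> cyc k i \<inter> cyc k j = {}" using C_disj I by blast
    qed
    also have "\<dots> = (\<Prod>i\<in>I. \<Prod>s\<in>{1..k i}. g (F i s) (F i (?nx i s)))"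
    proof (rule prod.cong[OF refl])
      fix i assume i: "i \<in> I"
      show "(\<Prod>m\<in>cyc k i. g (join F m) (join F (gam k r m)))
          = (\<Prod>s\<in>{1..k i}. g (F i s) (F i (?nx i s)))"
      proof (rule prod.reindex_bij_witness[where i = "\<lambda>s. off k i + s" and j = "\<lambda>m. m - off k i"])
        fix m assume "m \<in> cyc k i"
        then obtain s where s: "s \<in> {1..k i}" "m = off k i + s" by (rule cyc_shift)
        show "off k i + (m - off k i) = m" "m - off k i \<in> {1..k i}" using s by simp_all
        have "gam k r m = off k i + ?nx i s" unfolding s(2) by (rule gam_cyc) (use I i s in auto)
        then have "join F (gam k r m) = F i (?nx i s)" using join_app[OF i nx[OF s(1)]] by simp
        moreover have "join F m = F i s" unfolding s(2) by (rule join_app[OF i s(1)])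
        moreover have "m - off k i = s" using s(2) by simp
        ultimately show "g (F i (m - off k i)) (F i (?nx i (m - off k i)))
            = g (join F m) (join F (gam k r m))"
          by simp
      qed (auto simp: cyc_def)
    qed
    finally show "(\<Prod>m\<in>SS I. g (join F m) (join F (gam k r m)))
        = (\<Prod>i\<in>I. \<Prod>s\<in>{1..k i}. g (F i s) (F i (?nx i s)))" .
  next
    fix f assume f: "f \<in> ?T"
    then have fP: "f \<in> PiE (SS I) (\<lambda>_. {1..n})" by blast
    show "join (split f) = f"
    proof (rule extensionalityI[of _ "SS I"])
      show "f \<in> extensional (SS I)" using fP by (simp add: PiE_def)
      fix m assume "m \<in> SS I"
      then obtain i s where is': "i \<in> I" "s \<in> {1..k i}" "m = off k i + s" by (rule SS_cases)
      then show "join (split f) m = f m" using join_app split_app by simp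
    qed (simp add: join_def)
    show "split f \<in> PiE I ?A"
    proof (rule PiE_I)
      fix i assume i: "i \<in> I"
      have "split f i \<in> PiE {1..k i} (\<lambda>_. {1..n})"
      proof (rule PiE_I)
        fix s assume s: "s \<in> {1..k i}"
        show "split f i s \<in> {1..n}" unfolding split_app[OF i s]
          by (rule PiE_mem[OF fP shift_in_SS[OF i s]])
      qed (use i in \<open>auto simp: split_def\<close>)
      moreover have "ker (k i) (split f i) = \<sigma> i"
      proof -
        have "ker (k i) (split f i) = ker (k i) (\<lambda>s. f (off k i + s))"
          unfolding ker_eq_kern by (rule kern_cong) (rule split_app[OF i])
        also have "\<dots> = \<sigma> i" using f i restr_kern[OF I i, of f] by simp
        finally show ?thesis .
      qed
      ultimately show "split f i \<in> ?A i" by blast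
    qed (simp add: split_def)
  qed
  finally show ?thesis .
qed

text \<open>Everything asked of \<open>q\<close> except connectedness, relative to a subfamily
  \<open>I\<close>, so that it can be imposed on each component separately.\<close>

definition admissible :: "(nat \<Rightarrow> nat set set) \<Rightarrow> nat set \<Rightarrow> nat set set \<Rightarrow> bool" where
  "admissible \<sigma> I q \<longleftrightarrow> (\<forall>B\<in>q. even (card B)) \<and> pimage (gam k r) q = q \<and> (\<forall>i\<in>I. restr k q i = \<sigma> i)"

text \<open>Sorting the functions in \<open>prod_Zfun\<close> by their kernel leaves a contribution
  0 or 1 for each kernel. The clause that \<open>q\<close> is a kernel stays because
  \<open>n\<close> is arbitrary here.\<close>

lemma haarE_prod_Zfun:
  assumes I: "I \<subseteq> {1..r}"
  shows "haarE n (\<lambda>g. \<Prod>i\<in>I. Zfun n (k i) (\<sigma> i) g) =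
    real (card {q. partition_on (SS I) q \<and> admissible \<sigma> I q \<and>
      (\<exists>f\<in>PiE (SS I) (\<lambda>_. {1..n}). kern (SS I) f = q)})"
proof -
  let ?S = "SS I" and ?\<gamma> = "gam k r" and ?P = "PiE (SS I) (\<lambda>_. {1..n})"
  let ?A = "{f \<in> ?P. \<forall>i\<in>I. restr k (kern ?S f) i = \<sigma> i}"
  let ?ok = "\<lambda>q. pimage ?\<gamma> q = q \<and> (\<forall>B\<in>q. even (card B))"
  let ?E = "\<lambda>f. haarE n (\<lambda>g. \<Prod>m\<in>?S. g (f m) (f (?\<gamma> m)))"
  have finA: "finite ?A"
    using finite_SS[OF I] by (intro finite_subset[OF _ finite_PiE[of ?S "\<lambda>_. {1..n}"]]) auto
  have "haarE n (\<lambda>g. \<Prod>i\<in>I. Zfun n (k i) (\<sigma> i) g) = (\<Sum>f\<in>?A. ?E f)"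
    unfolding prod_Zfun[OF I] by (rule haarE_sum)
  also have "\<dots> = (\<Sum>q\<in>kern ?S ` ?A. \<Sum>f\<in>{f \<in> ?A. kern ?S f = q}. ?E f)"
    by (rule sum.image_gen[OF finA])
  also have "\<dots> = (\<Sum>q\<in>kern ?S ` ?A. if ?ok q then 1 else 0)"
  proof (rule sum.cong[OF refl])
    fix q assume q: "q \<in> kern ?S ` ?A"
    then obtain f0 where f0: "f0 \<in> ?P" "kern ?S f0 = q" "\<forall>i\<in>I. restr k q i = \<sigma> i" by blast
    \<comment> \<open>The restriction conditions see \<open>f\<close> only through its kernel, so
      all functions with kernel \<open>q\<close> take part, as \<open>sum_haarE_fixed_kern\<close>
      requires.\<close>
    then have eq: "{f \<in> ?A. kern ?S f = q} = {f \<in> ?P. kern ?S f = q}" by auto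
    have ne: "{f \<in> ?P. kern ?S f = q} \<noteq> {}" using f0(1,2) by blast
    show "(\<Sum>f\<in>{f \<in> ?A. kern ?S f = q}. ?E f) = (if ?ok q then 1 else 0)"
      unfolding eq sum_haarE_fixed_kern[OF finite_SS[OF I] bij_betw_gam[OF I] refl]
      using ne by (simp only: simp_thms)
  qed
  also have "\<dots> = real (card {q \<in> kern ?S ` ?A. ?ok q})"
    using finA by (simp add: sum.If_cases Int_def)
  also have "{q \<in> kern ?S ` ?A. ?ok q} = {q. partition_on ?S q \<and> admissible \<sigma> I q \<and> (\<exists>f\<in>?P. kern ?S f = q)}"
    unfolding admissible_def using partition_on_kern[of ?S] by blast
  finally show ?thesis .
qed

text \<open>All three conditions are local: \<gamma> maps every \<open>SS B\<close> to itself and so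
  never moves a block from one piece to another, and a cycle meets blocks of only one piece. This is
  the locality hypothesis of \<open>card_partitions_by_components\<close>.\<close>

lemma admissible_Union:
  assumes I: "I \<subseteq> {1..r}" and \<pi>: "partition_on I \<pi>"
    and F: "\<And>B. B \<in> \<pi> \<Longrightarrow> partition_on (SS B) (F B)"
  shows "admissible \<sigma> I (\<Union>B\<in>\<pi>. F B) \<longleftrightarrow> (\<forall>B\<in>\<pi>. admissible \<sigma> B (F B))"
proof -
  let ?q = "\<Union>B\<in>\<pi>. F B" and ?\<gamma> = "gam k r"
  have BI: "B \<subseteq> I" if "B \<in> \<pi>" for B using that partition_onD1[OF \<pi>] by blast
  have BU: "B \<subseteq> {1..r}" if "B \<in> \<pi>" for B using BI[OF that] I by blast
  have bS: "b \<subseteq> SS B" and bne: "b \<noteq> {}" if "B \<in> \<pi>" "b \<in> F B" for b B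
    using partition_onD1[OF F[OF that(1)]] partition_onD3[OF F[OF that(1)]] that by blast+
  have dis: "SS B \<inter> SS D = {}" if "B \<in> \<pi>" "D \<in> \<pi>" "B \<noteq> D" for B D
    using SS_disjoint[of B D] disjointD[OF partition_onD2[OF \<pi>] that] BU that by blast
  have gS: "?\<gamma> ` b \<subseteq> SS B" if "B \<in> \<pi>" "b \<in> F B" for b B
    using bij_betw_gam[OF BU[OF that(1)]] bS[OF that] unfolding bij_betw_def by blast
  have inF: "b \<in> F B" if "b \<in> ?q" "b \<subseteq> SS B" "B \<in> \<pi>" for b B
    using partition_on_SS_Union(2)[OF I \<pi> F that(3)] that by blast
  have 1: "(\<forall>b\<in>?q. even (card b)) \<longleftrightarrow> (\<forall>B\<in>\<pi>. \<forall>b\<in>F B. even (card b))" by blast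
  have 2: "pimage ?\<gamma> ?q = ?q \<longleftrightarrow> (\<forall>B\<in>\<pi>. pimage ?\<gamma> (F B) = F B)"
  proof
    assume eq: "pimage ?\<gamma> ?q = ?q"
    show "\<forall>B\<in>\<pi>. pimage ?\<gamma> (F B) = F B"
    proof
      fix B assume B: "B \<in> \<pi>"
      show "pimage ?\<gamma> (F B) = F B"
      proof (intro equalityI subsetI)
        fix b assume "b \<in> pimage ?\<gamma> (F B)"
        then obtain c where c: "c \<in> F B" "b = ?\<gamma> ` c" by (auto simp: pimage_def)
        have "b \<in> pimage ?\<gamma> ?q" unfolding pimage_def using c B by blast
        then have "b \<in> ?q" unfolding eq .
        then show "b \<in> F B" using inF gS[OF B c(1)] c(2) B by simp
      next
        fix b assume b: "b \<in> F B"
        then have "b \<in> ?q" using B by blast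
        then have "b \<in> pimage ?\<gamma> ?q" unfolding eq .
        then obtain c where c: "c \<in> ?q" "b = ?\<gamma> ` c" by (auto simp: pimage_def)
        then obtain D where D: "D \<in> \<pi>" "c \<in> F D" by blast
        have "b \<subseteq> SS D" using gS[OF D] c(2) by simp
        then have "D = B" using dis[OF D(1) B] bS[OF B b] bne[OF B b] by blast
        then show "b \<in> pimage ?\<gamma> (F B)" unfolding pimage_def using D c(2) by blast
      qed
    qed
  next
    assume eq: "\<forall>B\<in>\<pi>. pimage ?\<gamma> (F B) = F B"
    have "pimage ?\<gamma> ?q = (\<Union>B\<in>\<pi>. pimage ?\<gamma> (F B))" unfolding pimage_def by blast
    then show "pimage ?\<gamma> ?q = ?q" using eq by simp
  qed
  have res: "restr k ?q i = restr k (F B) i" if B: "B \<in> \<pi>" and i: "i \<in> B" for B i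
  proof -
    have "cyc k i \<subseteq> SS B" unfolding SS_def using i by blast
    then have "b \<in> F B" if "b \<in> ?q" "b \<inter> cyc k i \<noteq> {}" for b
      using that dis[OF _ B] bS by blast
    then have "b \<in> ?q \<and> b \<inter> cyc k i \<noteq> {} \<longleftrightarrow> b \<in> F B \<and> b \<inter> cyc k i \<noteq> {}" for b
      using B by blast
    then show ?thesis unfolding restr_def cyc_def[symmetric] by simp
  qed
  have 3: "(\<forall>i\<in>I. restr k ?q i = \<sigma> i) \<longleftrightarrow> (\<forall>B\<in>\<pi>. \<forall>i\<in>B. restr k (F B) i = \<sigma> i)"
  proof -
    have "I = \<Union>\<pi>" by (rule partition_onD1[OF \<pi>])
    then have "(\<forall>i\<in>I. restr k ?q i = \<sigma> i) \<longleftrightarrow> (\<forall>B\<in>\<pi>. \<forall>i\<in>B. restr k ?q i = \<sigma> i)" by blast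
    then show ?thesis using res by simp
  qed
  show ?thesis unfolding admissible_def 1 2 3 by blast
qed

section \<open>Parity, existence of kernels, and the passage from moments to cumulants\<close>

lemma even_card_SS:
  assumes "I \<subseteq> {1..r}" "partition_on (SS I) q" "admissible \<sigma> I q"
  shows "even (card (SS I))"
proof -
  have "card (SS I) = (\<Sum>B\<in>q. card B)"
  proof (rule product_partition[OF assms(2)])
    fix B assume "B \<in> q"
    then show "finite B"
      using partition_onD1[OF assms(2)] finite_SS[OF assms(1)] by (metis Union_upper finite_subset)
  qed
  then show ?thesis using assms(3) by (auto simp: admissible_def intro!: dvd_sum)
qed

text \<open>An even partition on some of the cycles extends to an even partition of the whole set with the
  complement as an additional block.\<close>

lemma kernel_exists_on_SS:
  assumes I: "I \<subseteq> {1..r}" and ev: "even (ktot k r)"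
    and inv: "invertible_on (Dpart (ktot k r)) (\<lambda>p q. real n ^ card (pjoin p q))"
    and q: "partition_on (SS I) q" "admissible \<sigma> I q"
  shows "\<exists>f\<in>PiE (SS I) (\<lambda>_. {1..n}). kern (SS I) f = q"
proof -
  let ?K = "{1..ktot k r}"
  \<comment> \<open>Removing \<open>{}\<close> covers the case that \<open>SS I\<close> is already
    everything, where the complement must not become an empty block.\<close>
  let ?p = "q \<union> ({?K - SS I} - {{}})"
  have sub: "SS I \<subseteq> ?K" using SS_mono[OF I] SS_all by simp
  have Uq: "\<Union>q = SS I" using partition_onD1[OF q(1)] by simp
  have p: "partition_on ?K ?p"
  proof (rule partition_onI)
    show "\<Union>?p = ?K" using Uq sub by auto
    show "{} \<notin> ?p" using partition_onD3[OF q(1)] by blast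
    fix b d assume "b \<in> ?p" "d \<in> ?p" "b \<noteq> d"
    then show "disjnt b d"
      using disjointD[OF partition_onD2[OF q(1)], of b d] Uq unfolding disjnt_def by blast
  qed
  have "card (?K - SS I) = ktot k r - card (SS I)"
    using card_Diff_subset[OF finite_SS[OF I] sub] by simp
  then have "even (card (?K - SS I))" using even_card_SS[OF I q] ev by simp
  then have "?p \<in> Dpart (ktot k r)"
    using p q(2) unfolding Dpart_def Part_def admissible_def by blast
  then obtain f where f: "f \<in> PiE ?K (\<lambda>_. {1..n})" "kern ?K f = ?p"
    using invertible_imp_kernel_exists[OF inv] by blast
  have same: "\<forall>x\<in>?K. \<forall>y\<in>?K. f x = f y \<longleftrightarrow> (\<exists>B\<in>?p. x \<in> B \<and> y \<in> B)"
    using f(2) unfolding kern_eq_partition_iff[OF p] .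
  have "restrict f (SS I) \<in> PiE (SS I) (\<lambda>_. {1..n})" using f(1) sub by auto
  moreover have "kern (SS I) (restrict f (SS I)) = q"
    unfolding kern_eq_partition_iff[OF q(1)]
  proof (intro ballI)
    fix x y assume xy: "x \<in> SS I" "y \<in> SS I"
    have "f x = f y \<longleftrightarrow> (\<exists>B\<in>?p. x \<in> B \<and> y \<in> B)" using same xy sub by blast
    also have "\<dots> \<longleftrightarrow> (\<exists>B\<in>q. x \<in> B \<and> y \<in> B)" using xy by blast
    finally show "restrict f (SS I) x = restrict f (SS I) y \<longleftrightarrow> (\<exists>B\<in>q. x \<in> B \<and> y \<in> B)"
      using xy by simp
  qed
  ultimately show ?thesis by blast
qed

text \<open>With every admissible partition realized as a kernel, the moment of each subfamily is a
  plain count, and counting by components has exactly the shape of the moment-cumulant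
  formula.\<close>

lemma cumulant_Zfun_even:
  assumes r: "r \<ge> 1" and ev: "even (ktot k r)"
    and inv: "invertible_on (Dpart (ktot k r)) (\<lambda>p q. real n ^ card (pjoin p q))"
  shows "cumulant (haarE n) (\<lambda>i. Zfun n (k i) (\<sigma> i)) {1..r} =
    real (card {q. partition_on (SS {1..r}) q \<and> admissible \<sigma> {1..r} q \<and> connected_on {1..r} q})"
proof (rule cumulant_eqI[where c = "\<lambda>B. real (card {q. partition_on (SS B) q \<and> admissible \<sigma> B q \<and> connected_on B q})"])
  show "{1..r} \<noteq> {}" using r by simp
  fix I assume I: "I \<subseteq> {1..r}"
  have "{q. partition_on (SS I) q \<and> admissible \<sigma> I q \<and> (\<exists>f\<in>PiE (SS I) (\<lambda>_. {1..n}). kern (SS I) f = q)}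
      = {q. partition_on (SS I) q \<and> admissible \<sigma> I q}"
    using kernel_exists_on_SS[OF I ev inv] by blast
  then have "haarE n (\<lambda>g. \<Prod>i\<in>I. Zfun n (k i) (\<sigma> i) g)
      = real (card {q. partition_on (SS I) q \<and> admissible \<sigma> I q})"
    using haarE_prod_Zfun[OF I] by simp
  also have "\<dots> = real (\<Sum>\<pi>\<in>{\<pi>. partition_on I \<pi>}. \<Prod>B\<in>\<pi>.
      card {q. partition_on (SS B) q \<and> admissible \<sigma> B q \<and> connected_on B q})"
    by (subst card_partitions_by_components[OF I, where Good = "admissible \<sigma>"])
      (rule admissible_Union[OF I], auto)
  finally show "haarE n (\<lambda>g. \<Prod>i\<in>I. Zfun n (k i) (\<sigma> i) g) =
      (\<Sum>\<pi>\<in>{\<pi>. partition_on I \<pi>}. \<Prod>B\<in>\<pi>.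
        real (card {q. partition_on (SS B) q \<and> admissible \<sigma> B q \<and> connected_on B q}))"
    by simp
qed simp

text \<open>For odd \<open>k\<close> the set \<open>D\<^sub>k\<close> is empty, so the invertibility hypothesis is vacuous and \<open>n\<close> is
  arbitrary; all relevant moments vanish by parity.\<close>

lemma cumulant_Zfun_odd:
  assumes odd: "odd (ktot k r)"
  shows "cumulant (haarE n) (\<lambda>i. Zfun n (k i) (\<sigma> i)) {1..r} = 0"
proof (rule cumulant_odd[where w = k])
  show "odd (\<Sum>i\<in>{1..r}. k i)" using odd by (simp add: ktot_def)
  fix I assume I: "I \<subseteq> {1..r}" and o: "odd (\<Sum>i\<in>I. k i)"
  have "{q. partition_on (SS I) q \<and> admissible \<sigma> I q \<and> (\<exists>f\<in>PiE (SS I) (\<lambda>_. {1..n}). kern (SS I) f = q)} = {}"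
    using even_card_SS[OF I] o card_SS[OF I] by auto
  then show "haarE n (\<lambda>g. \<Prod>i\<in>I. Zfun n (k i) (\<sigma> i) g) = 0"
    unfolding haarE_prod_Zfun[OF I] by (simp only: card.empty of_nat_0)
qed simp

lemma Dpart_count_eq:
  assumes "r \<ge> 1"
  shows "{q \<in> Dpart (ktot k r). pimage (gam k r) q = q \<and> pjoin q (gpart k r) = {{1..ktot k r}}
      \<and> (\<forall>i\<in>{1..r}. restr k q i = \<sigma> i)}
    = {q. partition_on (SS {1..r}) q \<and> admissible \<sigma> {1..r} q \<and> connected_on {1..r} q}"
proof -
  have "{1..r} \<noteq> {}" using assms by simp
  note c = connected_on_iff_pjoin[OF _ this, unfolded gpart_eq[symmetric] SS_all]
  show ?thesis
  proof (intro set_eqI, unfold Dpart_def Part_def admissible_def SS_all mem_Collect_eq)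
    fix q
    show "((partition_on {1..ktot k r} q \<and> (\<forall>B\<in>q. even (card B))) \<and> pimage (gam k r) q = q
        \<and> pjoin q (gpart k r) = {{1..ktot k r}} \<and> (\<forall>i\<in>{1..r}. restr k q i = \<sigma> i)) \<longleftrightarrow>
      (partition_on {1..ktot k r} q \<and> ((\<forall>B\<in>q. even (card B)) \<and> pimage (gam k r) q = q
        \<and> (\<forall>i\<in>{1..r}. restr k q i = \<sigma> i)) \<and> connected_on {1..r} q)"
      using c[of q] by argo
  qed
qed

end

theorem theorem7p3:
  fixes r :: nat and k :: "nat \<Rightarrow> nat" and \<sigma> :: "nat \<Rightarrow> nat set set" and n :: nat
  assumes r_pos: "r \<ge> 1"
    and k_pos: "\<forall>i\<in>{1..r}. k i \<ge> 1"
    and sigma: "\<forall>i\<in>{1..r}. \<sigma> i \<in> Part (k i)"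
    and inv: "invertible_on (Dpart (ktot k r)) (\<lambda>p q. real n ^ card (pjoin p q))"
  shows "cumulant (haarE n) (\<lambda>i. Zfun n (k i) (\<sigma> i)) {1..r}
       = real (card {q \<in> Dpart (ktot k r).
                  pimage (gam k r) q = q
                \<and> pjoin q (gpart k r) = {{1..ktot k r}}
                \<and> (\<forall>i\<in>{1..r}. restr k q i = \<sigma> i)})"
proof -
  interpret trace_cycles k r using k_pos by unfold_locales blast
  show ?thesis
  proof (cases "even (ktot k r)")
    case True
    then show ?thesis unfolding Dpart_count_eq[OF r_pos] by (rule cumulant_Zfun_even[OF r_pos _ inv])
  next
    case False
    \<comment> \<open>An odd number of points has no partition into even blocks, so the count is 0
      and matches the vanishing cumulant.\<close>
    have "{q. partition_on (SS {1..r}) q \<and> admissible \<sigma> {1..r} q \<and> connected_on {1..r} q} = {}"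
      using even_card_SS[OF subset_refl, of _ \<sigma>] False SS_all by auto
    then show ?thesis
      unfolding Dpart_count_eq[OF r_pos] cumulant_Zfun_odd[OF False] by (simp only: card.empty of_nat_0)
  qed
qed

end
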